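(* For every integer $n\ge 0$ and every $r\in\{132,164,228,292,356,388\}$, $$v_0(416n+r)\equiv 0\pmod{13}.$$
   Context: The integer sequence $v_0(n)$, $n\ge 0$, is defined by the generating function (formal power series in $q$) $$\sum_{n=0}^\infty v_0(n)q^n=\sum_{n=0}^\infty \frac{q^{n^2}(-q;q^2)_n}{(q;q^2)_n},$$ where $(a;q)_0=1$ and $(a;q)_n=\prod_{i=1}^n(1-aq^{i-1})$ for $n\ge1$, so that $(-q;q^2)_n=\prod_{i=1}^n(1+q^{2i-1})$ and $(q;q^2)_n=\prod_{i=1}^n(1-q^{2i-1})$. *)

theory Defs
  imports "HOL-Computational_Algebra.Formal_Power_Series" "HOL-Number_Theory.Cong"
begin

definition qpoch :: "'a::comm_ring_1 \<Rightarrow> 'a \<Rightarrow> nat \<Rightarrow> 'a" where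
  "qpoch a q n = (\<Prod>i=1..n. 1 - a * q ^ (i - 1))"

definition v0_term :: "nat \<Rightarrow> rat fps" where
  "v0_term n =
     fps_X ^ n\<^sup>2 * qpoch (- fps_X) (fps_X\<^sup>2) n / qpoch fps_X (fps_X\<^sup>2) n"

text \<open>
  The sum is taken in the standard (\<open>X\<close>-adic) topology on formal power series. The series live over
  the rationals only so that the division is available; lemma \<open>v0_sums\<close> below shows that the
  integer sequence described here does exist.
\<close>
definition v0 :: "nat \<Rightarrow> int" where
  "v0 = (THE v. v0_term sums Abs_fps (\<lambda>n. of_int (v n)))"

lemma int_coeffs_mult:
  fixes f g :: "rat fps"
  assumes "\<And>n. fps_nth f n \<in> \<int>" "\<And>n. fps_nth g n \<in> \<int>"
  shows "fps_nth (f * g) n \<in> \<int>"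
  using assms by (auto simp: fps_mult_nth intro!: Ints_sum Ints_mult)

lemma int_coeffs_prod:
  fixes f :: "'i \<Rightarrow> rat fps"
  assumes "\<And>i n. i \<in> A \<Longrightarrow> fps_nth (f i) n \<in> \<int>"
  shows "fps_nth (prod f A) n \<in> \<int>"
  using assms
proof (induction A arbitrary: n rule: infinite_finite_induct)
  case (insert x A)
  then show ?case by (auto intro!: int_coeffs_mult)
qed auto

lemma int_coeffs_power:
  fixes f :: "rat fps"
  assumes "\<And>n. fps_nth f n \<in> \<int>"
  shows "fps_nth (f ^ k) n \<in> \<int>"
proof (induction k arbitrary: n)
  case (Suc k)
  then show ?case using assms by (auto intro!: int_coeffs_mult)
qed auto

lemma int_coeffs_inverse:
  fixes f :: "rat fps"
  assumes "\<And>n. fps_nth f n \<in> \<int>" "fps_nth f 0 = 1"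
  shows "fps_nth (inverse f) n \<in> \<int>"
proof (induction n rule: less_induct)
  case (less n)
  show ?case
  proof (cases "n = 0")
    case False
    have "f * inverse f = 1"
      using assms(2) by (simp add: inverse_mult_eq_1')
    then have "(\<Sum>i=0..n. fps_nth f i * fps_nth (inverse f) (n - i)) = 0"
      using False by (metis fps_mult_nth fps_one_nth)
    moreover have "(\<Sum>i=0..n. fps_nth f i * fps_nth (inverse f) (n - i)) =
        fps_nth (inverse f) n + (\<Sum>i=Suc 0..n. fps_nth f i * fps_nth (inverse f) (n - i))"
      using assms(2) by (subst sum.atLeast_Suc_atMost) auto
    ultimately have "fps_nth (inverse f) n =
        - (\<Sum>i=Suc 0..n. fps_nth f i * fps_nth (inverse f) (n - i))"
      by simp
    also have "\<dots> \<in> \<int>"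
      using assms(1) less.IH by (intro Ints_minus Ints_sum Ints_mult) auto
    finally show ?thesis .
  qed (use assms in simp)
qed

lemma int_coeffs_fps_X: "fps_nth (fps_X :: rat fps) n \<in> \<int>"
  by (simp add: fps_X_def)

lemma int_coeffs_qpoch:
  fixes a q :: "rat fps"
  assumes "\<And>n. fps_nth a n \<in> \<int>" "\<And>n. fps_nth q n \<in> \<int>"
  shows "fps_nth (qpoch a q k) n \<in> \<int>"
  unfolding qpoch_def fps_sub_nth
  by (intro int_coeffs_prod)
     (auto simp: fps_one_nth intro!: Ints_diff int_coeffs_mult int_coeffs_power assms)

lemma qpoch_nth_0:
  assumes "fps_nth a 0 = 0"
  shows "fps_nth (qpoch a q k) 0 = 1"
  using assms by (induction k) (auto simp: qpoch_def)

lemma v0_term_altdef: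
  "v0_term n =
     fps_X ^ n\<^sup>2 * (qpoch (- fps_X) (fps_X\<^sup>2) n * inverse (qpoch fps_X (fps_X\<^sup>2) n))"
  by (simp add: v0_term_def fps_divide_unit qpoch_nth_0 mult.assoc)

lemma v0_term_nth_Ints: "fps_nth (v0_term k) n \<in> \<int>"
  unfolding v0_term_altdef
  by (intro int_coeffs_mult int_coeffs_power int_coeffs_inverse int_coeffs_qpoch)
     (auto simp: int_coeffs_fps_X int_coeffs_power qpoch_nth_0)

lemma v0_term_nth_eq_0: "m < k \<Longrightarrow> fps_nth (v0_term k) m = 0"
proof -
  assume "m < k"
  then have "m < k\<^sup>2"
    by (metis le_square less_le_trans power2_eq_square)
  then show ?thesis
    by (simp add: v0_term_altdef fps_X_power_mult_nth)
qed

lemma v0_sums: "v0_term sums Abs_fps (\<lambda>n. of_int (v0 n))"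
proof -
  define v where "v m = \<lfloor>\<Sum>k\<le>m. fps_nth (v0_term k) m\<rfloor>" for m
  have v: "of_int (v m) = (\<Sum>k\<le>m. fps_nth (v0_term k) m)" for m
    unfolding v_def by (intro of_int_floor Ints_sum v0_term_nth_Ints)
  have *: "v0_term sums Abs_fps (\<lambda>n. of_int (v n))"
    unfolding sums_def
  proof (rule tendsto_fpsI)
    fix m
    show "\<forall>\<^sub>F N in sequentially.
        fps_nth (\<Sum>k<N. v0_term k) m = fps_nth (Abs_fps (\<lambda>n. of_int (v n))) m"
      using eventually_gt_at_top[of m]
    proof eventually_elim
      case (elim N)
      have "(\<Sum>k<N. fps_nth (v0_term k) m) = (\<Sum>k\<le>m. fps_nth (v0_term k) m)"
        using elim by (intro sum.mono_neutral_right) (auto simp: v0_term_nth_eq_0)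
      then show ?case by (simp add: fps_sum_nth v)
    qed
  qed
  have "w = v" if "v0_term sums Abs_fps (\<lambda>n. of_int (w n))" for w
  proof -
    have "Abs_fps (\<lambda>n. of_int (w n) :: rat) = Abs_fps (\<lambda>n. of_int (v n))"
      using sums_unique2[OF that *] .
    then show ?thesis by (simp add: fps_eq_iff fun_eq_iff)
  qed
  with * have "v0 = v"
    unfolding v0_def by (intro the_equality)
  with * show ?thesis by simp
qed

end

(*
  Let V(q) = sum v_0(n) q^n. In the bilateral series sum_{n in Z} q^(n^2) (-q;q^2)_n / (q;q^2)_n the
  terms with n <= 0 add up to V(-q), so that its value is V(q) + V(-q) - 1. Inserting a parameter s makes
  it satisfy a first-order equation under s -> s q^2 (by telescoping), which evaluates it as
  phi(q^2)^2 / phi(-q^4), where phi(q) = sum_{n in Z} q^(n^2). A further dissection, with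
  psi(q) = sum_{n >= 0} q^(n(n+1)/2), gives
    sum v_0(32n+4) q^n = 3 psi(q) + 512 q psi(q)^9 / phi(-q)^8.
  Let e(q) be Euler's pentagonal number series. From psi(q) = e(q^2)^2/e(q) and
  phi(-q) = e(q)^2/e(q^2) one gets psi(q)^9/phi(-q)^8 = e(q) K(q)^13 with the integral series
  K(q) = e(q^2)/phi(-q). Modulo 13, K(q)^13 is a series in q^13, so completing the square in the
  exponents of psi(q) and q e(q) shows that v_0(N) can only be nonzero modulo 13, for N = 32n+4,
  if N is a square modulo 13. The six values of r are nonresidues.
*)
theory Submission
  imports Defs
begin

unbundle fps_syntax

text \<open>The parameter \<open>s\<close> is itself a power series, so that the functional equation
  can be iterated: s q^(2k) tends to 0 adically, where the bilateral series collapses to phi(q^2),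
  while the factors collected on the way become infinite products. The same device, applied to the
  Rogers-Fine series with parameter \<open>b\<close>, supplies every product formula for phi, psi
  and e. The dissection is a rationalisation. By phi(q^2)^2 = phi(q^4)^2 + 4 q^2 psi(q^8)^2, only
  phi(q^4)^2 / phi(-q^4) reaches exponents divisible by 4. It equals (a + b)^2 / (a - b) with a
  series a in q^16 and with b at exponents 4 mod 16. Multiplying above and below by (a + b)(a^2 +
  b^2) gives the denominator a^4 - b^4 = phi(-q^16)^4, a series in q^16, so that the power of b
  determines the residue modulo 16. A second round passes to modulus 32. The prime 13 fits because
  psi(q)^9/phi(-q)^8 = e(q^2)^26/e(q)^25 is one factor e(q) away from a 13th power. The pentagonal
  exponents make 3N a square modulo 13, and 3 = 4^2 there.\<close>

section \<open>The adic topology on formal power series\<close>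

instance fps :: (ab_group_add) topological_ab_group_add
proof
  fix a b :: "'a fps"
  have "eventually (\<lambda>x. fst x $ n + snd x $ n = a $ n + b $ n) (nhds a \<times>\<^sub>F nhds b)" for n
    unfolding eventually_prod_filter
    using eventually_fps_nth_eq_nhds_fps[of n a] eventually_fps_nth_eq_nhds_fps[of n b] by force
  then show "((\<lambda>x. fst x + snd x) \<longlongrightarrow> a + b) (nhds a \<times>\<^sub>F nhds b)"
    by (simp add: tendsto_fps_iff)
  have "eventually (\<lambda>x. (- x) $ n = (- a) $ n) (nhds a)" for n
    using eventually_fps_nth_eq_nhds_fps[of n a] by eventually_elim simp
  then show "(uminus \<longlongrightarrow> - a) (nhds a)"
    by (simp add: tendsto_fps_iff)
qed

text \<open>Coefficient n of a product depends only on the coefficients of the factors up to n. The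
  instance opens the general limit rules for products to the adic topology.\<close>

instance fps :: (comm_ring_1) topological_comm_monoid_mult
proof
  fix a b :: "'a fps"
  have "eventually (\<lambda>x. (fst x * snd x) $ n = (a * b) $ n) (nhds a \<times>\<^sub>F nhds b)" for n
    unfolding eventually_prod_filter
  proof (intro exI conjI allI impI)
    show "eventually (\<lambda>f. \<forall>k\<le>n. f $ k = a $ k) (nhds a)"
      "eventually (\<lambda>f. \<forall>k\<le>n. f $ k = b $ k) (nhds b)"
      by (rule eventually_fps_nth_eq_nhds_fps_strong)+
  next
    fix f g :: "'a fps"
    assume "\<forall>k\<le>n. f $ k = a $ k" "\<forall>k\<le>n. g $ k = b $ k"
    then show "(fst (f, g) * snd (f, g)) $ n = (a * b) $ n"
      by (auto simp: fps_mult_nth intro!: sum.cong)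
  qed
  then show "((\<lambda>x. fst x * snd x) \<longlongrightarrow> a * b) (nhds a \<times>\<^sub>F nhds b)"
    by (simp add: tendsto_fps_iff)
qed

lemma sums_mult_left_fps:
  fixes f :: "nat \<Rightarrow> 'a::comm_ring_1 fps"
  assumes "f sums s"
  shows "(\<lambda>n. c * f n) sums (c * s)"
  using tendsto_mult_left[OF assms[unfolded sums_def], of c]
  by (simp add: sums_def sum_distrib_left)

lemma sums_diff_fps:
  fixes f g :: "nat \<Rightarrow> 'a::ab_group_add fps"
  assumes "f sums s" "g sums t"
  shows "(\<lambda>n. f n - g n) sums (s - t)"
  using tendsto_diff[OF assms[unfolded sums_def]]
  by (simp add: sums_def sum_subtractf)

lemma mult_power_nth_less:
  fixes q :: "'a::comm_ring_1 fps"
  assumes "q $ 0 = 0" "i < k"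
  shows "(q ^ k * h) $ i = 0" "(h * q ^ k) $ i = 0"
proof -
  have "q ^ k $ j = 0" if "j \<le> i" for j
    using startsby_zero_power_prefix[OF assms(1)] that assms(2) by auto
  then show "(q ^ k * h) $ i = 0"
    by (auto simp: fps_mult_nth intro!: sum.neutral)
  then show "(h * q ^ k) $ i = 0" by (simp add: mult.commute)
qed

lemma LIMSEQ_mult_power_fps:
  fixes q :: "'a::comm_ring_1 fps"
  assumes "q $ 0 = 0"
  shows "(\<lambda>n. h n * q ^ n) \<longlonglongrightarrow> 0"
proof (rule tendsto_fpsI)
  fix i
  show "eventually (\<lambda>n. (h n * q ^ n) $ i = 0 $ i) sequentially"
    using eventually_gt_at_top[of i]
    by eventually_elim (simp add: mult_power_nth_less assms)
qed

text \<open>Stronger than tending to 0: coefficient i of the sum involves only the terms up to i, a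
  bound shared by all sequences of this kind.\<close>

definition adic_null :: "(nat \<Rightarrow> 'a::zero fps) \<Rightarrow> bool" where
  "adic_null f \<longleftrightarrow> (\<forall>n i. i < n \<longrightarrow> f n $ i = 0)"

lemma adic_null_power_mult:
  fixes q :: "'a::comm_ring_1 fps"
  assumes "q $ 0 = 0" "\<And>n. n \<le> e n"
  shows "adic_null (\<lambda>n. q ^ e n * h n)"
  unfolding adic_null_def using assms by (auto intro!: mult_power_nth_less order.strict_trans2[OF _ assms(2)])

lemma adic_null_sums:
  fixes f :: "nat \<Rightarrow> 'a::ab_group_add fps"
  assumes "adic_null f"
  shows "f sums Abs_fps (\<lambda>i. \<Sum>n\<le>i. f n $ i)"
  unfolding sums_def
proof (rule tendsto_fpsI)
  fix i
  show "\<forall>\<^sub>F N in sequentially. (\<Sum>n<N. f n) $ i = Abs_fps (\<lambda>i. \<Sum>n\<le>i. f n $ i) $ i"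
    using eventually_gt_at_top[of i]
  proof eventually_elim
    case (elim N)
    have "(\<Sum>n<N. f n $ i) = (\<Sum>n\<le>i. f n $ i)"
      using elim assms by (intro sum.mono_neutral_right) (auto simp: adic_null_def)
    then show ?case by (simp add: fps_sum_nth)
  qed
qed

lemma adic_null_sums_suminf:
  fixes f :: "nat \<Rightarrow> 'a::ab_group_add fps"
  assumes "adic_null f"
  shows "f sums (\<Sum>n. f n)"
  using adic_null_sums[OF assms] by (simp add: sums_iff)

lemma suminf_nth:
  fixes f :: "nat \<Rightarrow> 'a::ab_group_add fps"
  assumes "adic_null f"
  shows "(\<Sum>n. f n) $ i = (\<Sum>n\<le>i. f n $ i)"
  using adic_null_sums[OF assms] by (simp add: sums_iff)

text \<open>Dominated convergence: the uniform bound of \<open>adic_null\<close> leaves finitely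
  many terms for each coefficient, so termwise limits suffice.\<close>

lemma tendsto_suminf_fps:
  fixes f :: "nat \<Rightarrow> nat \<Rightarrow> 'a::ab_group_add fps"
  assumes "\<And>k. adic_null (f k)" "adic_null g" "\<And>n. (\<lambda>k. f k n) \<longlonglongrightarrow> g n"
  shows "(\<lambda>k. \<Sum>n. f k n) \<longlonglongrightarrow> (\<Sum>n. g n)"
proof (rule tendsto_fpsI)
  fix i
  have "eventually (\<lambda>k. \<forall>n\<in>{..i}. f k n $ i = g n $ i) sequentially"
    using assms(3) by (intro eventually_ball_finite) (auto simp: tendsto_fps_iff)
  then show "eventually (\<lambda>k. (\<Sum>n. f k n) $ i = (\<Sum>n. g n) $ i) sequentially"
    by eventually_elim (simp add: suminf_nth assms)
qed

section \<open>Infinite q-Pochhammer symbols\<close>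

lemma qpoch_0 [simp]: "qpoch a q 0 = 1"
  by (simp add: qpoch_def)

lemma qpoch_Suc: "qpoch a q (Suc n) = qpoch a q n * (1 - a * q ^ n)"
  by (simp add: qpoch_def)

lemma qpoch_Suc': "qpoch a q (Suc n) = (1 - a) * qpoch (a * q) q n"
  by (induction n) (simp_all add: qpoch_Suc mult_ac)

lemma qpoch_double: "qpoch a q (2 * n) = qpoch a (q\<^sup>2) n * qpoch (a * q) (q\<^sup>2) n"
proof (induction n)
  case (Suc n)
  have "qpoch a q (2 * Suc n) = qpoch a q (2 * n) * (1 - a * (q\<^sup>2) ^ n) * (1 - a * q * (q\<^sup>2) ^ n)"
    by (simp add: qpoch_Suc mult.assoc power_mult)
  also have "\<dots> = qpoch a (q\<^sup>2) (Suc n) * qpoch (a * q) (q\<^sup>2) (Suc n)"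
    unfolding Suc qpoch_Suc by (simp only: mult_ac)
  finally show ?case .
qed simp

lemma qpoch_mult_minus: "qpoch a q n * qpoch (- a) q n = qpoch (a\<^sup>2) (q\<^sup>2) n"
proof (induction n)
  case (Suc n)
  have *: "(1 - a * q ^ n) * (1 - - a * q ^ n) = 1 - a\<^sup>2 * (q\<^sup>2) ^ n"
    by (simp add: algebra_simps power2_eq_square power_mult_distrib)
  have "qpoch a q (Suc n) * qpoch (- a) q (Suc n) =
      (qpoch a q n * qpoch (- a) q n) * ((1 - a * q ^ n) * (1 - - a * q ^ n))"
    by (simp only: qpoch_Suc mult_ac)
  also have "\<dots> = qpoch (a\<^sup>2) (q\<^sup>2) (Suc n)"
    by (simp only: Suc * qpoch_Suc)
  finally show ?case .
qed simp

definition qinf :: "'a::comm_ring_1 fps \<Rightarrow> 'a fps \<Rightarrow> 'a fps" where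
  "qinf a q = lim (qpoch a q)"

lemma LIMSEQ_qpoch:
  fixes q :: "'a::comm_ring_1 fps"
  assumes "q $ 0 = 0"
  shows "qpoch a q \<longlonglongrightarrow> qinf a q"
proof -
  \<comment> \<open>The new factor 1 - a q^n is 1 modulo q^n and leaves the coefficients below n
    alone.\<close>
  have stable: "qpoch a q n $ i = qpoch a q (Suc i) $ i" if "Suc i \<le> n" for n i
    using that
  proof (induction n rule: dec_induct)
    case (step n)
    have "qpoch a q (Suc n) = qpoch a q n - (qpoch a q n * a) * q ^ n"
      by (simp add: qpoch_Suc algebra_simps)
    with step show ?case
      by (simp add: mult_power_nth_less(2) assms)
  qed simp
  have *: "qpoch a q \<longlonglongrightarrow> Abs_fps (\<lambda>i. qpoch a q (Suc i) $ i)"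
  proof (rule tendsto_fpsI)
    fix i
    show "eventually (\<lambda>n. qpoch a q n $ i = Abs_fps (\<lambda>i. qpoch a q (Suc i) $ i) $ i) sequentially"
      using eventually_ge_at_top[of "Suc i"]
    proof eventually_elim
      case (elim n)
      from stable[OF this] show ?case by simp
    qed
  qed
  have "qinf a q = Abs_fps (\<lambda>i. qpoch a q (Suc i) $ i)"
    unfolding qinf_def by (rule limI) (rule *)
  with * show ?thesis by (simp only:)
qed

lemma qinf_Suc:
  fixes q :: "'a::comm_ring_1 fps"
  assumes "q $ 0 = 0"
  shows "qinf a q = (1 - a) * qinf (a * q) q"
  using LIMSEQ_Suc[OF LIMSEQ_qpoch[OF assms, of a]]
    tendsto_mult_left[OF LIMSEQ_qpoch[OF assms, of "a * q"], of "1 - a"]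
  by (intro LIMSEQ_unique) (auto simp: qpoch_Suc')

lemma qinf_double:
  fixes q :: "'a::comm_ring_1 fps"
  assumes "q $ 0 = 0"
  shows "qinf a q = qinf a (q\<^sup>2) * qinf (a * q) (q\<^sup>2)"
proof (rule LIMSEQ_unique)
  have "strict_mono (\<lambda>n::nat. 2 * n)" by (simp add: strict_mono_def)
  from LIMSEQ_subseq_LIMSEQ[OF LIMSEQ_qpoch[OF assms, of a] this]
  show "(\<lambda>n. qpoch a q (2 * n)) \<longlonglongrightarrow> qinf a q" by (simp add: o_def)
  have "q\<^sup>2 $ 0 = 0" using assms by (simp add: power2_eq_square)
  then show "(\<lambda>n. qpoch a q (2 * n)) \<longlonglongrightarrow> qinf a (q\<^sup>2) * qinf (a * q) (q\<^sup>2)"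
    unfolding qpoch_double by (intro tendsto_mult LIMSEQ_qpoch)
qed

lemma qinf_mult_minus:
  fixes q :: "'a::comm_ring_1 fps"
  assumes "q $ 0 = 0"
  shows "qinf a q * qinf (- a) q = qinf (a\<^sup>2) (q\<^sup>2)"
proof (rule LIMSEQ_unique)
  show "(\<lambda>n. qpoch (a\<^sup>2) (q\<^sup>2) n) \<longlonglongrightarrow> qinf a q * qinf (- a) q"
    unfolding qpoch_mult_minus[symmetric] by (intro tendsto_mult LIMSEQ_qpoch assms)
  show "(\<lambda>n. qpoch (a\<^sup>2) (q\<^sup>2) n) \<longlonglongrightarrow> qinf (a\<^sup>2) (q\<^sup>2)"
    using assms by (intro LIMSEQ_qpoch) (simp add: power2_eq_square)
qed

text \<open>Licenses cancelling infinite products: the formulas below are kept multiplied out and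
  solved in the integral domain of power series.\<close>

lemma qinf_nonzero:
  fixes q :: "'a::comm_ring_1 fps"
  assumes "q $ 0 = 0" "a $ 0 = 0"
  shows "qinf a q \<noteq> 0"
proof -
  have "eventually (\<lambda>n. qpoch a q n $ 0 = qinf a q $ 0) sequentially"
    using LIMSEQ_qpoch[OF assms(1), of a] by (simp add: tendsto_fps_iff)
  moreover have "qpoch a q n $ 0 = 1" for n
    by (induction n) (simp_all add: qpoch_Suc assms)
  ultimately have "qinf a q $ 0 = 1"
    by (metis (mono_tags, lifting) eventually_happens sequentially_bot)
  then show ?thesis by auto
qed

section \<open>Fine's expansion of a quotient of infinite products\<close>

definition theta_phi :: "'a::field fps \<Rightarrow> 'a fps" where
  "theta_phi q = 2 * (\<Sum>n. q ^ n\<^sup>2) - 1"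

text \<open>The exponents are the triangular numbers \<open>k(k+1)/2\<close> for \<open>k = 2n\<close> and \<open>k = 2n+1\<close>.\<close>

definition theta_psi :: "'a::field fps \<Rightarrow> 'a fps" where
  "theta_psi q = (\<Sum>n. q ^ (2 * n\<^sup>2 + n) * (1 + q ^ (2 * n + 1)))"

text \<open>Euler's sum over all integers k of (-1)^k q^(k(3k+1)/2), with the terms k = n and k =
  -n-1 put together.\<close>

definition pentagonal :: "'a::field fps \<Rightarrow> 'a fps" where
  "pentagonal q = (\<Sum>n. q ^ (n * (3 * n + 1) div 2) * ((- 1) ^ n * (1 - q ^ (2 * n + 1))))"


text \<open>This and the primed version express the inverses in neighbouring terms by one common
  inverse, which reduces the telescoping steps below to polynomial identities.\<close>

lemma inverse_qpoch_Suc: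
  fixes a q :: "'a::field fps"
  assumes "a $ 0 = 0"
  shows "inverse (qpoch a q n) = (1 - a * q ^ n) * inverse (qpoch a q (Suc n))"
proof -
  have "(1 - a * q ^ n) * inverse (1 - a * q ^ n) = 1"
    by (intro inverse_mult_eq_1') (simp add: assms)
  then show ?thesis
    by (simp add: qpoch_Suc fps_inverse_mult mult.left_commute)
qed

lemma inverse_qpoch_Suc':
  fixes a q :: "'a::field fps"
  assumes "a $ 0 = 0"
  shows "inverse (qpoch (a * q) q n) = (1 - a) * inverse (qpoch a q (Suc n))"
proof -
  have "(1 - a) * inverse (1 - a) = 1"
    by (intro inverse_mult_eq_1') (simp add: assms)
  then show ?thesis
    by (simp add: qpoch_Suc' fps_inverse_mult mult.assoc [symmetric])
qed

lemma LIMSEQ_qpoch_arg: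
  fixes q :: "'a::comm_ring_1 fps"
  assumes "a \<longlonglongrightarrow> L"
  shows "(\<lambda>k. qpoch (a k) q n) \<longlonglongrightarrow> qpoch L q n"
  by (induction n) (auto simp: qpoch_Suc intro!: tendsto_intros assms)

text \<open>
  The Rogers--Fine identity multiplied by \<open>1 - t\<close>, in the limit \<open>t \<rightarrow> 1\<close> for its argument \<open>t\<close>.
  The values \<open>b = 1\<close>, \<open>b = -1\<close> and \<open>b = q\<close> (with \<open>q\<^sup>2\<close> for \<open>q\<close>) yield the product formulas for
  \<open>pentagonal\<close>, \<open>theta_phi\<close> and \<open>theta_psi\<close>.
\<close>

definition fine_term :: "'a::field fps \<Rightarrow> 'a fps \<Rightarrow> nat \<Rightarrow> 'a fps" where
  "fine_term b q n =
     q ^ n\<^sup>2 * ((\<Prod>i<n. b - q ^ Suc i) * inverse (qpoch (b * q) q n) * (1 - q ^ (2 * n + 1)))"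

lemma adic_null_fine_term:
  assumes "q $ 0 = 0"
  shows "adic_null (fine_term b q)"
  unfolding fine_term_def using assms
  by (intro adic_null_power_mult) (auto simp: power2_eq_square)

text \<open>A telescoping certificate for the shift b -> b q: the right-hand side is the boundary
  term after index m, which vanishes in the limit.\<close>

lemma fine_term_partial_sum:
  fixes b q :: "'a::field fps"
  assumes "q $ 0 = 0"
  shows "(\<Sum>n<Suc m. (1 - b * q) * fine_term b q n - fine_term (b * q) q n) =
    q ^ (Suc m)\<^sup>2 * ((1 - b * q) * b * (q ^ Suc m - 1) *
      (\<Prod>i<m. b - q ^ Suc i) * inverse (qpoch (b * q) q (Suc m)))"
proof (induction m)
  case 0
  have "(1 - b * q) * inverse (1 - b * q) = 1"
    by (intro inverse_mult_eq_1') (simp add: assms)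
  then have "q * ((1 - b * q) * b * (q - 1) * inverse (1 - b * q)) = q * (b * (q - 1))"
    by algebra
  then show ?case
    by (simp add: fine_term_def qpoch_Suc algebra_simps)
next
  case (Suc m)
  define A where "A = (\<Prod>i<m. b - q ^ Suc i)"
  define I where "I = inverse (qpoch (b * q) q (Suc (Suc m)))"
  define N where "N = q ^ Suc m"
  define S where "S = q ^ (Suc m)\<^sup>2"
  have bq: "(b * q) $ 0 = 0" by (simp add: assms)
  have I1: "inverse (qpoch (b * q) q (Suc m)) = (1 - b * q * N) * I"
    unfolding I_def N_def by (rule inverse_qpoch_Suc) (fact bq)
  have I2: "inverse (qpoch (b * q * q) q (Suc m)) = (1 - b * q) * I"
    unfolding I_def by (rule inverse_qpoch_Suc') (fact bq)
  have P1: "(\<Prod>i<Suc m. b - q ^ Suc i) = A * (b - N)"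
    by (simp add: A_def N_def)
  \<comment> \<open>Taking q out of each factor lowers its index by one; the factor of index 0
    becomes b - 1.\<close>
  have "(\<Prod>i<Suc n. b * q - q ^ Suc i) = q ^ Suc n * ((b - 1) * (\<Prod>i<n. b - q ^ Suc i))" for n
  proof (induction n)
    case (Suc n)
    show ?case
      unfolding prod.lessThan_Suc [of _ "Suc n"] Suc.IH
      unfolding prod.lessThan_Suc by (simp add: algebra_simps)
  qed (simp add: algebra_simps)
  then have P2: "(\<Prod>i<Suc m. b * q - q ^ Suc i) = N * ((b - 1) * A)"
    by (simp only: N_def A_def)
  have N2: "q ^ (2 * Suc m + 1) = N\<^sup>2 * q"
    unfolding N_def power_mult [symmetric] power_Suc2 [symmetric] by (rule arg_cong) simp
  have S2: "q ^ (Suc (Suc m))\<^sup>2 = S * (N\<^sup>2 * q)"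
    unfolding S_def N2 [symmetric] power_add [symmetric]
    by (rule arg_cong [of _ _ "power q"]) (simp add: power2_eq_square)
  have "(\<Sum>n<Suc (Suc m). (1 - b * q) * fine_term b q n - fine_term (b * q) q n) =
      S * ((1 - b * q) * b * (N - 1) * A * ((1 - b * q * N) * I)) +
      ((1 - b * q) * (S * (A * (b - N) * ((1 - b * q * N) * I) * (1 - N\<^sup>2 * q))) -
       S * (N * ((b - 1) * A) * ((1 - b * q) * I) * (1 - N\<^sup>2 * q)))"
    unfolding sum.lessThan_Suc [of _ "Suc m"] Suc.IH
    unfolding fine_term_def I1 I2 P1 P2 N2
    by (simp only: A_def [symmetric] N_def [symmetric] S_def [symmetric])
  also have "\<dots> = S * (N\<^sup>2 * q) * ((1 - b * q) * b * (N * q - 1) * (A * (b - N)) * I)"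
    by algebra
  finally show ?case
    unfolding S2 P1 by (simp add: I_def N_def mult_ac)
qed

lemma fine_shift:
  fixes b q :: "'a::field fps"
  assumes "q $ 0 = 0"
  shows "(1 - b * q) * suminf (fine_term b q) = suminf (fine_term (b * q) q)"
proof -
  have "(\<lambda>n. (1 - b * q) * fine_term b q n - fine_term (b * q) q n) sums
      ((1 - b * q) * suminf (fine_term b q) - suminf (fine_term (b * q) q))"
    by (intro sums_diff_fps sums_mult_left_fps adic_null_sums_suminf adic_null_fine_term assms)
  then have "(\<lambda>m. \<Sum>n<Suc m. (1 - b * q) * fine_term b q n - fine_term (b * q) q n) \<longlonglongrightarrow>
      (1 - b * q) * suminf (fine_term b q) - suminf (fine_term (b * q) q)"
    unfolding sums_def by (rule LIMSEQ_Suc)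
  moreover have "(\<lambda>m. \<Sum>n<Suc m. (1 - b * q) * fine_term b q n - fine_term (b * q) q n) \<longlonglongrightarrow> 0"
  proof -
    \<comment> \<open>Splits off the factor q^m that \<open>LIMSEQ_mult_power_fps\<close> asks
      for.\<close>
    have "q ^ (Suc m)\<^sup>2 * h = (q ^ (m\<^sup>2 + m + 1) * h) * q ^ m" for m h
      by (simp add: power2_eq_square power_add mult_ac)
    then show ?thesis
      unfolding fine_term_partial_sum[OF assms]
      by (simp only: LIMSEQ_mult_power_fps assms)
  qed
  ultimately show ?thesis
    using LIMSEQ_unique by fastforce
qed

lemma fine_shift_power:
  fixes b q :: "'a::field fps"
  assumes "q $ 0 = 0"
  shows "suminf (fine_term b q) * qpoch (b * q) q k = suminf (fine_term (b * q ^ k) q)"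
proof (induction k)
  case (Suc k)
  have "suminf (fine_term b q) * qpoch (b * q) q (Suc k) =
      (1 - b * q ^ k * q) * (suminf (fine_term b q) * qpoch (b * q) q k)"
    by (simp add: qpoch_Suc mult_ac)
  also have "\<dots> = suminf (fine_term (b * q ^ k * q) q)"
    unfolding Suc by (rule fine_shift[OF assms])
  finally show ?case by (simp add: mult_ac)
qed simp

text \<open>At b = 0 the product is (-1)^n q^(n(n+1)/2), and n^2 + n(n+1)/2 = n(3n+1)/2.\<close>

lemma fine_term_0: "fine_term 0 q n = q ^ (n * (3 * n + 1) div 2) * ((- 1) ^ n * (1 - q ^ (2 * n + 1)))"
proof -
  have "(Suc n * (3 * Suc n + 1)) div 2 = n * (3 * n + 1) div 2 + 3 * n + 2" for n :: nat
  proof -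
    have "Suc n * (3 * Suc n + 1) = n * (3 * n + 1) + 2 * (3 * n + 2)" by (simp add: algebra_simps)
    then show ?thesis by simp
  qed
  then have "q ^ n\<^sup>2 * (\<Prod>i<n. 0 - q ^ Suc i) = q ^ (n * (3 * n + 1) div 2) * (- 1) ^ n"
  proof (induction n)
    case (Suc n)
    have "q ^ (Suc n)\<^sup>2 * (\<Prod>i<Suc n. 0 - q ^ Suc i) =
        (q ^ n\<^sup>2 * (\<Prod>i<n. 0 - q ^ Suc i)) * (- (q ^ (3 * n + 2)))"
      by (simp add: power2_eq_square power_add mult_ac eval_nat_numeral)
    then show ?case
      using Suc by (simp only: Suc) (simp add: power_add mult_ac)
  qed simp
  moreover have "qpoch (0 * q) q n = 1"
    by (simp add: qpoch_def)
  ultimately show ?thesis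
    by (simp add: fine_term_def mult.assoc [symmetric])
qed

text \<open>Iterating the shift sends b to 0 and collects the factors of \<open>qinf\<close>. The
  right-hand side is free of b, so each b with a recognisable series gives a product
  formula.\<close>

lemma suminf_fine_term:
  fixes b q :: "'a::field fps"
  assumes "q $ 0 = 0"
  shows "suminf (fine_term b q) * qinf (b * q) q = pentagonal q"
proof (rule LIMSEQ_unique)
  show "(\<lambda>k. suminf (fine_term b q) * qpoch (b * q) q k) \<longlonglongrightarrow> suminf (fine_term b q) * qinf (b * q) q"
    by (intro tendsto_intros LIMSEQ_qpoch assms)
  have lim: "(\<lambda>k. b * q ^ k) \<longlonglongrightarrow> 0"
    by (intro LIMSEQ_mult_power_fps assms)
  have inv: "(\<lambda>k. inverse (qpoch (b * q ^ k * q) q n)) \<longlonglongrightarrow> inverse (qpoch (0 * q) q n)" for n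
    by (intro tendsto_inverse_fps LIMSEQ_qpoch_arg tendsto_intros lim) (simp_all add: qpoch_nth_0 assms)
  have "(\<lambda>k. fine_term (b * q ^ k) q n) \<longlonglongrightarrow> fine_term 0 q n" for n
    unfolding fine_term_def
    by (intro tendsto_mult tendsto_diff tendsto_const tendsto_prod' lim inv)
  then have "(\<lambda>k. suminf (fine_term (b * q ^ k) q)) \<longlonglongrightarrow> suminf (fine_term 0 q)"
    using tendsto_suminf_fps[of "\<lambda>k. fine_term (b * q ^ k) q" "fine_term 0 q"]
    by (simp add: adic_null_fine_term assms)
  then show "(\<lambda>k. suminf (fine_term b q) * qpoch (b * q) q k) \<longlonglongrightarrow> pentagonal q"
    by (simp add: fine_shift_power assms fine_term_0 [abs_def] pentagonal_def)
qed

section \<open>A bilateral series\<close>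

text \<open>
  \<open>s = 1\<close> gives the terms of the generating function of \<open>v0\<close>. The terms for \<open>- s\<close> are those of the
  bilateral series for \<open>s\<close> at negative indices.
\<close>

definition bilateral_term :: "'a::field fps \<Rightarrow> 'a fps \<Rightarrow> nat \<Rightarrow> 'a fps" where
  "bilateral_term s q n = q ^ n\<^sup>2 * ((\<Prod>i<n. s + q ^ (2 * i + 1)) * inverse (qpoch (s * q) (q\<^sup>2) n))"

lemma adic_null_u_term:
  assumes "q $ 0 = 0"
  shows "adic_null (bilateral_term s q)"
  unfolding bilateral_term_def using assms
  by (intro adic_null_power_mult) (auto simp: power2_eq_square)

text \<open>A certificate for s -> s q^2. Only half of the bilateral series is summed, so a boundary
  term s q - s^2 q^2 remains at the lower end.\<close>

lemma bilateral_term_partial_sum: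
  fixes s q :: "'a::field fps"
  assumes "q $ 0 = 0"
  shows "(\<Sum>n<Suc m. (1 - s\<^sup>2 * q\<^sup>2) * bilateral_term s q n - (1 + s\<^sup>2 * q\<^sup>2) * bilateral_term (s * q\<^sup>2) q n) =
    (s * q - s\<^sup>2 * q\<^sup>2) - q ^ (Suc m)\<^sup>2 * ((1 - s\<^sup>2 * q\<^sup>2) * s *
      (\<Prod>i<m. s + q ^ (2 * i + 1)) * inverse (qpoch (s * q) (q\<^sup>2) (Suc m)))"
proof (induction m)
  case 0
  have "(1 - s * q) * inverse (1 - s * q) = 1"
    by (intro inverse_mult_eq_1') (simp add: assms)
  then have "q * ((1 - s\<^sup>2 * q\<^sup>2) * s * inverse (1 - s * q)) = q * s * (1 + s * q)"
    by algebra
  then show ?case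
    by (simp add: bilateral_term_def qpoch_Suc) algebra
next
  case (Suc m)
  define A where "A = (\<Prod>i<m. s + q ^ (2 * i + 1))"
  define I where "I = inverse (qpoch (s * q) (q\<^sup>2) (Suc (Suc m)))"
  define R where "R = q ^ (2 * m + 1)"
  define S where "S = q ^ (Suc m)\<^sup>2"
  have sq: "(s * q) $ 0 = 0" by (simp add: assms)
  have R2: "(q\<^sup>2) ^ Suc m = R * q"
    unfolding R_def power_Suc2 [symmetric] power_mult [symmetric] by (rule arg_cong) simp
  have I1: "inverse (qpoch (s * q) (q\<^sup>2) (Suc m)) = (1 - s * q * (R * q)) * I"
    unfolding I_def R2 [symmetric] by (rule inverse_qpoch_Suc) (fact sq)
  have "s * q\<^sup>2 * q = s * q * q\<^sup>2" by (simp add: mult_ac)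
  then have I2: "inverse (qpoch (s * q\<^sup>2 * q) (q\<^sup>2) (Suc m)) = (1 - s * q) * I"
    unfolding I_def using inverse_qpoch_Suc'[OF sq, of "q\<^sup>2" "Suc m"] by (simp only:)
  have P1: "(\<Prod>i<Suc m. s + q ^ (2 * i + 1)) = A * (s + R)"
    by (simp add: A_def R_def)
  \<comment> \<open>Taking q^2 out of the factors of positive index lowers their index by one; the
    factor of index 0 gives q (s q + 1).\<close>
  have "(\<Prod>i<Suc n. s * q\<^sup>2 + q ^ (2 * i + 1)) = q ^ (2 * n + 1) * ((s * q + 1) * (\<Prod>i<n. s + q ^ (2 * i + 1)))" for n
    by (induction n) (simp_all add: algebra_simps power2_eq_square)
  then have P2: "(\<Prod>i<Suc m. s * q\<^sup>2 + q ^ (2 * i + 1)) = R * ((s * q + 1) * A)"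
    by (simp only: R_def A_def)
  have S2: "q ^ (Suc (Suc m))\<^sup>2 = S * (R * q\<^sup>2)"
    unfolding S_def R_def power_add [symmetric]
    by (rule arg_cong [of _ _ "power q"]) (simp add: power2_eq_square)
  have "(\<Sum>n<Suc (Suc m). (1 - s\<^sup>2 * q\<^sup>2) * bilateral_term s q n - (1 + s\<^sup>2 * q\<^sup>2) * bilateral_term (s * q\<^sup>2) q n) =
      (s * q - s\<^sup>2 * q\<^sup>2) - S * ((1 - s\<^sup>2 * q\<^sup>2) * s * A * ((1 - s * q * (R * q)) * I)) +
      ((1 - s\<^sup>2 * q\<^sup>2) * (S * (A * (s + R) * ((1 - s * q * (R * q)) * I))) -
       (1 + s\<^sup>2 * q\<^sup>2) * (S * (R * ((s * q + 1) * A) * ((1 - s * q) * I))))"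
    unfolding sum.lessThan_Suc [of _ "Suc m"] Suc.IH
    unfolding bilateral_term_def I1 I2 P1 P2
    by (simp only: A_def [symmetric] S_def [symmetric])
  also have "\<dots> = (s * q - s\<^sup>2 * q\<^sup>2) - S * (R * q\<^sup>2) * ((1 - s\<^sup>2 * q\<^sup>2) * s * (A * (s + R)) * I)"
    by algebra
  finally show ?case
    unfolding S2 P1 by (simp add: I_def)
qed

lemma bilateral_term_shift:
  fixes s q :: "'a::field fps"
  assumes "q $ 0 = 0"
  shows "(1 - s\<^sup>2 * q\<^sup>2) * suminf (bilateral_term s q) - (1 + s\<^sup>2 * q\<^sup>2) * suminf (bilateral_term (s * q\<^sup>2) q) =
    s * q - s\<^sup>2 * q\<^sup>2" (is "?l = ?r")
proof -
  let ?f = "\<lambda>n. (1 - s\<^sup>2 * q\<^sup>2) * bilateral_term s q n - (1 + s\<^sup>2 * q\<^sup>2) * bilateral_term (s * q\<^sup>2) q n"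
  have "?f sums ?l"
    by (intro sums_diff_fps sums_mult_left_fps adic_null_sums_suminf adic_null_u_term assms)
  then have "(\<lambda>m. \<Sum>n<Suc m. ?f n) \<longlonglongrightarrow> ?l"
    unfolding sums_def by (rule LIMSEQ_Suc)
  moreover have "(\<lambda>m. \<Sum>n<Suc m. ?f n) \<longlonglongrightarrow> ?r - 0"
  proof -
    have "q ^ (Suc m)\<^sup>2 * h = (q ^ (m\<^sup>2 + m + 1) * h) * q ^ m" for m h
      by (simp add: power2_eq_square power_add mult_ac)
    then show ?thesis
      unfolding bilateral_term_partial_sum[OF assms]
      by (intro tendsto_diff tendsto_const) (simp only: LIMSEQ_mult_power_fps assms)
  qed
  ultimately show ?thesis
    using LIMSEQ_unique by fastforce
qed

lemma bilateral_shift_power: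
  fixes s q :: "'a::field fps"
  assumes "q $ 0 = 0"
  defines "F \<equiv> \<lambda>s. suminf (bilateral_term s q) + suminf (bilateral_term (- s) q) - 1"
  shows "F s * qpoch (s\<^sup>2 * q\<^sup>2) (q ^ 4) k = qpoch (- (s\<^sup>2 * q\<^sup>2)) (q ^ 4) k * F (s * (q\<^sup>2) ^ k)"
proof (induction k)
  case (Suc k)
  define t where "t = s * (q\<^sup>2) ^ k"
  have t2: "t\<^sup>2 * q\<^sup>2 = s\<^sup>2 * q\<^sup>2 * (q ^ 4) ^ k"
    by (simp add: t_def power_mult_distrib mult_ac flip: power_mult)
  \<comment> \<open>Adding the equations for t and -t cancels the odd part of the boundary term; the
    remaining -2 t^2 q^2 is absorbed by the \<open>- 1\<close> in \<open>F\<close>. The equation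
    becomes homogeneous.\<close>
  have *: "(1 - t\<^sup>2 * q\<^sup>2) * F t = (1 + t\<^sup>2 * q\<^sup>2) * F (t * q\<^sup>2)"
    using bilateral_term_shift[OF assms(1), of t] bilateral_term_shift[OF assms(1), of "- t"]
    by (simp add: F_def) algebra
  have "F s * qpoch (s\<^sup>2 * q\<^sup>2) (q ^ 4) (Suc k) =
      (F s * qpoch (s\<^sup>2 * q\<^sup>2) (q ^ 4) k) * (1 - t\<^sup>2 * q\<^sup>2)"
    by (simp only: qpoch_Suc t2 mult.assoc)
  also have "\<dots> = qpoch (- (s\<^sup>2 * q\<^sup>2)) (q ^ 4) k * ((1 - t\<^sup>2 * q\<^sup>2) * F t)"
    unfolding Suc by (simp only: t_def mult_ac)
  also have "\<dots> = qpoch (- (s\<^sup>2 * q\<^sup>2)) (q ^ 4) (Suc k) * F (t * q\<^sup>2)"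
    unfolding * by (simp add: qpoch_Suc t2 mult.assoc)
  finally show ?case by (simp add: t_def mult_ac)
qed (simp add: F_def)

lemma bilateral_term_0: "bilateral_term 0 q n = (q\<^sup>2) ^ n\<^sup>2"
proof -
  have "(\<Prod>i<n. 0 + q ^ (2 * i + 1)) = q ^ n\<^sup>2"
  proof (induction n)
    case (Suc n)
    have "(\<Prod>i<Suc n. 0 + q ^ (2 * i + 1)) = q ^ n\<^sup>2 * q ^ (2 * n + 1)"
      unfolding prod.lessThan_Suc Suc by simp
    also have "\<dots> = q ^ (Suc n)\<^sup>2"
      unfolding power_add [symmetric]
      by (rule arg_cong [of _ _ "power q"]) (simp add: power2_eq_square)
    finally show ?case .
  qed simp
  moreover have "qpoch (0 * q) (q\<^sup>2) n = 1"
    by (simp add: qpoch_def)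
  ultimately show ?thesis
    by (simp add: bilateral_term_def power2_eq_square power_mult_distrib)
qed

lemma bilateral_sum:
  fixes s q :: "'a::field fps"
  assumes "q $ 0 = 0"
  shows "(suminf (bilateral_term s q) + suminf (bilateral_term (- s) q) - 1) * qinf (s\<^sup>2 * q\<^sup>2) (q ^ 4) =
    qinf (- (s\<^sup>2 * q\<^sup>2)) (q ^ 4) * theta_phi (q\<^sup>2)"
proof -
  define F where "F = (\<lambda>s. suminf (bilateral_term s q) + suminf (bilateral_term (- s) q) - 1)"
  have q4: "q ^ 4 $ 0 = 0" using assms by simp
  have "(\<lambda>k. suminf (bilateral_term (c * (q\<^sup>2) ^ k) q)) \<longlonglongrightarrow> suminf (bilateral_term 0 q)" for c
  proof -
    have lim: "(\<lambda>k. c * (q\<^sup>2) ^ k) \<longlonglongrightarrow> 0"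
      using assms by (intro LIMSEQ_mult_power_fps) simp
    have inv: "(\<lambda>k. inverse (qpoch (c * (q\<^sup>2) ^ k * q) (q\<^sup>2) n)) \<longlonglongrightarrow> inverse (qpoch (0 * q) (q\<^sup>2) n)" for n
      by (intro tendsto_inverse_fps LIMSEQ_qpoch_arg tendsto_intros lim) (simp_all add: qpoch_nth_0 assms)
    have "(\<lambda>k. bilateral_term (c * (q\<^sup>2) ^ k) q n) \<longlonglongrightarrow> bilateral_term 0 q n" for n
      unfolding bilateral_term_def
      by (intro tendsto_mult tendsto_add tendsto_const tendsto_prod' lim inv)
    then show ?thesis
      using tendsto_suminf_fps[of "\<lambda>k. bilateral_term (c * (q\<^sup>2) ^ k) q" "bilateral_term 0 q"]
      by (simp add: adic_null_u_term assms)
  qed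
  from this[of s] this[of "- s"]
  have "(\<lambda>k. F (s * (q\<^sup>2) ^ k)) \<longlonglongrightarrow> suminf (bilateral_term 0 q) + suminf (bilateral_term 0 q) - 1"
    unfolding F_def by (intro tendsto_intros) simp_all
  moreover have "suminf (bilateral_term 0 q) + suminf (bilateral_term 0 q) - 1 = theta_phi (q\<^sup>2)"
    by (simp add: theta_phi_def bilateral_term_0 [abs_def])
  ultimately have "(\<lambda>k. qpoch (- (s\<^sup>2 * q\<^sup>2)) (q ^ 4) k * F (s * (q\<^sup>2) ^ k)) \<longlonglongrightarrow>
      qinf (- (s\<^sup>2 * q\<^sup>2)) (q ^ 4) * theta_phi (q\<^sup>2)"
    by (intro tendsto_mult LIMSEQ_qpoch q4) simp
  moreover have "(\<lambda>k. F s * qpoch (s\<^sup>2 * q\<^sup>2) (q ^ 4) k) \<longlonglongrightarrow> F s * qinf (s\<^sup>2 * q\<^sup>2) (q ^ 4)"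
    by (intro tendsto_intros LIMSEQ_qpoch q4)
  ultimately show ?thesis
    unfolding F_def bilateral_shift_power[OF assms] using LIMSEQ_unique by blast
qed

section \<open>Theta functions\<close>

lemma telescope_sums_fps:
  fixes f :: "nat \<Rightarrow> 'a::ab_group_add fps"
  assumes "f \<longlonglongrightarrow> 0"
  shows "(\<lambda>n. f n - f (Suc n)) sums f 0"
  using tendsto_diff[OF tendsto_const[of "f 0"] assms]
  by (simp add: sums_def sum_lessThan_telescope')

lemma square_power_sums:
  fixes q :: "'a::comm_ring_1 fps"
  assumes "q $ 0 = 0"
  shows "(\<lambda>n. q ^ n\<^sup>2) sums (\<Sum>n. q ^ n\<^sup>2)"
  using adic_null_power_mult[OF assms, of "\<lambda>n. n\<^sup>2" "\<lambda>_. 1"]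
  by (simp add: adic_null_sums_suminf power2_eq_square)

lemma square_power_telescope:
  fixes q :: "'a::comm_ring_1 fps"
  assumes "q $ 0 = 0"
  shows "(\<lambda>n. q ^ n\<^sup>2 - q ^ (Suc n)\<^sup>2) sums 1"
proof -
  have "q ^ n\<^sup>2 = q ^ (n * (n - 1)) * q ^ n" for n
    by (cases n) (simp_all add: power2_eq_square power_add mult_ac)
  then have "(\<lambda>n. q ^ n\<^sup>2) \<longlonglongrightarrow> 0"
    by (simp only: LIMSEQ_mult_power_fps[OF assms])
  from telescope_sums_fps[OF this] show ?thesis by simp
qed

section \<open>Product formulas for Euler's series, phi and psi\<close>

lemma prod_eq_qpoch: "(\<Prod>i<n. 1 - a * q ^ i) = qpoch a q n"
  by (induction n) (simp_all add: qpoch_Suc)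

text \<open>Euler's pentagonal number theorem: at b = 1 the products in \<open>fine_term\<close>
  cancel, and the remaining series telescopes to 1.\<close>

lemma pentagonal_eq_qinf:
  fixes q :: "'a::field fps"
  assumes q: "q $ 0 = 0"
  shows "pentagonal q = qinf q q"
proof -
  have "fine_term 1 q n = q ^ n\<^sup>2 - q ^ (Suc n)\<^sup>2" for n
  proof -
    have "(\<Prod>i<n. 1 - q ^ Suc i) = qpoch q q n"
      using prod_eq_qpoch[of q q n] by simp
    moreover have "qpoch q q n * inverse (qpoch q q n) = 1"
      by (intro inverse_mult_eq_1') (simp add: qpoch_nth_0 q)
    moreover have "q ^ (Suc n)\<^sup>2 = q ^ n\<^sup>2 * q ^ (2 * n + 1)"
      unfolding power_add [symmetric]
      by (rule arg_cong [of _ _ "power q"]) (simp add: power2_eq_square)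
    ultimately show ?thesis
      by (simp add: fine_term_def right_diff_distrib)
  qed
  then have "fine_term 1 q = (\<lambda>n. q ^ n\<^sup>2 - q ^ (Suc n)\<^sup>2)"
    by (rule ext)
  then have "fine_term 1 q sums 1"
    using square_power_telescope[OF q] by (simp only:)
  then show ?thesis
    using suminf_fine_term[OF q, of 1] by (simp add: sums_iff)
qed

lemma phi_minus_product:
  fixes q :: "'a::field fps"
  assumes q: "q $ 0 = 0"
  shows "theta_phi (- q) * qinf (- q) q = qinf q q"
proof -
  define a where "a n = (- q) ^ n\<^sup>2" for n
  \<comment> \<open>The term is \<open>a n + a (Suc n)\<close>; in this form the telescoping part
    sums to 1 and yields the \<open>- 1\<close> of \<open>theta_phi\<close>.\<close>
  have "fine_term (- 1) q n = 2 * a n - (a n - a (Suc n))" for n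
  proof -
    have sgn: "(\<Prod>i<n. - 1 - q ^ Suc i) = (- 1) ^ n * qpoch (- q) q n"
      by (induction n) (simp_all add: qpoch_Suc algebra_simps)
    moreover have inv: "qpoch (- q) q n * inverse (qpoch (- q) q n) = 1"
      by (intro inverse_mult_eq_1') (simp add: qpoch_nth_0 q)
    moreover have a: "a n = (- 1) ^ n * q ^ n\<^sup>2" for n
      by (simp add: a_def power_minus [of q] power2_eq_square minus_one_power_iff)
    moreover have "q ^ (Suc n)\<^sup>2 = q ^ n\<^sup>2 * q ^ (2 * n + 1)"
      unfolding power_add [symmetric]
      by (rule arg_cong [of _ _ "power q"]) (simp add: power2_eq_square)
    ultimately have "2 * a n - (a n - a (Suc n)) = (- 1) ^ n * q ^ n\<^sup>2 * (1 - q ^ (2 * n + 1))"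
      by (simp only: a) (simp add: algebra_simps)
    also have "\<dots> = q ^ n\<^sup>2 * ((- 1) ^ n * (qpoch (- q) q n * inverse (qpoch (- q) q n)) * (1 - q ^ (2 * n + 1)))"
      unfolding inv by (simp only: mult_ac mult_1_right mult_1_left)
    also have "\<dots> = fine_term (- 1) q n"
      unfolding fine_term_def sgn by (simp add: mult.assoc)
    finally show ?thesis ..
  qed
  then have "fine_term (- 1) q = (\<lambda>n. 2 * a n - (a n - a (Suc n)))"
    by (rule ext)
  moreover have "(\<lambda>n. 2 * a n - (a n - a (Suc n))) sums (2 * (\<Sum>n. (- q) ^ n\<^sup>2) - 1)"
    unfolding a_def using q
    by (intro sums_diff_fps sums_mult_left_fps square_power_telescope square_power_sums) simp_all
  ultimately have "fine_term (- 1) q sums theta_phi (- q)"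
    by (simp only: theta_phi_def)
  then show ?thesis
    using suminf_fine_term[OF q, of "- 1"] by (simp add: sums_iff pentagonal_eq_qinf q)
qed

lemma adic_null_psi_term:
  fixes q :: "'a::comm_ring_1 fps"
  assumes "q $ 0 = 0"
  shows "adic_null (\<lambda>n. q ^ (2 * n\<^sup>2 + n) * (1 + q ^ (2 * n + 1)))"
  using assms by (intro adic_null_power_mult) simp_all

lemma psi_product:
  fixes q :: "'a::field fps"
  assumes q: "q $ 0 = 0"
  shows "theta_psi q * qinf q (q\<^sup>2) = qinf (q\<^sup>2) (q\<^sup>2)"
proof -
  have q2: "q\<^sup>2 $ 0 = 0" using q by simp
  have "fine_term q (q\<^sup>2) n = (1 - q) * (q ^ (2 * n\<^sup>2 + n) * (1 + q ^ (2 * n + 1)))" for n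
  proof -
    define I where "I = inverse (qpoch (q * q\<^sup>2) (q\<^sup>2) n)"
    have inv: "qpoch (q * q\<^sup>2) (q\<^sup>2) n * I = 1"
      unfolding I_def by (intro inverse_mult_eq_1') (simp add: qpoch_nth_0 q)
    have A: "(\<Prod>i<n. q - (q\<^sup>2) ^ Suc i) = q ^ n * qpoch q (q\<^sup>2) n"
      by (induction n) (simp_all add: qpoch_Suc algebra_simps power2_eq_square)
    have "qpoch q (q\<^sup>2) n * (1 - q * (q\<^sup>2) ^ n) = (1 - q) * qpoch (q * q\<^sup>2) (q\<^sup>2) n"
      using qpoch_Suc[of q "q\<^sup>2" n] qpoch_Suc'[of q "q\<^sup>2" n] by simp
    then have B: "qpoch q (q\<^sup>2) n * (1 - q ^ (2 * n + 1)) = (1 - q) * qpoch (q * q\<^sup>2) (q\<^sup>2) n"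
      by (simp add: power_mult)
    have C: "1 - (q\<^sup>2) ^ (2 * n + 1) = (1 - q ^ (2 * n + 1)) * (1 + q ^ (2 * n + 1))"
      by (simp add: algebra_simps power2_eq_square power_mult_distrib power_add)
    have "fine_term q (q\<^sup>2) n = ((q\<^sup>2) ^ n\<^sup>2 * q ^ n) * (qpoch q (q\<^sup>2) n * (1 - q ^ (2 * n + 1))) * I * (1 + q ^ (2 * n + 1))"
      unfolding fine_term_def A C I_def [symmetric] by (simp only: mult_ac)
    also have "\<dots> = ((q\<^sup>2) ^ n\<^sup>2 * q ^ n) * (1 - q) * (qpoch (q * q\<^sup>2) (q\<^sup>2) n * I) * (1 + q ^ (2 * n + 1))"
      unfolding B by (simp only: mult_ac)
    also have "(q\<^sup>2) ^ n\<^sup>2 * q ^ n = q ^ (2 * n\<^sup>2 + n)"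
      by (simp only: power_add power_mult)
    finally show ?thesis
      unfolding inv by (simp only: mult_ac mult_1_right mult_1_left)
  qed
  then have "fine_term q (q\<^sup>2) = (\<lambda>n. (1 - q) * (q ^ (2 * n\<^sup>2 + n) * (1 + q ^ (2 * n + 1))))"
    by (rule ext)
  then have "fine_term q (q\<^sup>2) sums ((1 - q) * theta_psi q)"
    unfolding theta_psi_def
    using sums_mult_left_fps[OF adic_null_sums_suminf[OF adic_null_psi_term[OF q]], of "1 - q"] by (simp only:)
  then have "(1 - q) * theta_psi q * qinf (q * q\<^sup>2) (q\<^sup>2) = qinf (q\<^sup>2) (q\<^sup>2)"
    using suminf_fine_term[OF q2, of q] by (simp add: sums_iff pentagonal_eq_qinf q2)
  \<comment> \<open>The factor 1 - q is the first factor of \<open>qinf q (q\<^sup>2)\<close>,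
    missing from the product that starts at q^3.\<close>
  then show ?thesis
    by (simp add: qinf_Suc[OF q2, of q] mult_ac)
qed

text \<open>\<open>phi_minus_product\<close> with - q for q: as (- q)^2 = q^2,
  \<open>qinf_double\<close> splits both products over the base q^2, and a second use, at q^2,
  removes the common factor.\<close>

lemma phi_ratio:
  fixes q :: "'a::field fps"
  assumes q: "q $ 0 = 0"
  shows "theta_phi q * qinf q (q\<^sup>2) = theta_phi (- (q\<^sup>2)) * qinf (- q) (q\<^sup>2)"
proof -
  have mq: "(- q) $ 0 = 0" and q2: "q\<^sup>2 $ 0 = 0" using q by simp_all
  have "theta_phi q * qinf q (- q) = qinf (- q) (- q)"
    using phi_minus_product[OF mq] by simp
  moreover have "qinf q (- q) = qinf q (q\<^sup>2) * qinf (- (q\<^sup>2)) (q\<^sup>2)"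
    "qinf (- q) (- q) = qinf (- q) (q\<^sup>2) * qinf (q\<^sup>2) (q\<^sup>2)"
    using qinf_double[OF mq, of q] qinf_double[OF mq, of "- q"] by (simp_all add: power2_eq_square)
  moreover have "theta_phi (- (q\<^sup>2)) * qinf (- (q\<^sup>2)) (q\<^sup>2) = qinf (q\<^sup>2) (q\<^sup>2)"
    by (rule phi_minus_product[OF q2])
  ultimately have "(theta_phi q * qinf q (q\<^sup>2)) * qinf (- (q\<^sup>2)) (q\<^sup>2) =
      (theta_phi (- (q\<^sup>2)) * qinf (- q) (q\<^sup>2)) * qinf (- (q\<^sup>2)) (q\<^sup>2)"
    by algebra
  moreover have "qinf (- (q\<^sup>2)) (q\<^sup>2) \<noteq> 0"
    using q by (intro qinf_nonzero) simp_all
  ultimately show ?thesis by simp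
qed

lemma phi_mult_phi_minus:
  fixes q :: "'a::field fps"
  assumes q: "q $ 0 = 0"
  shows "theta_phi q * theta_phi (- q) = (theta_phi (- (q\<^sup>2)))\<^sup>2"
proof -
  have mq: "(- q) $ 0 = 0" using q by simp
  have "theta_phi q * theta_phi (- q) * (qinf q (q\<^sup>2) * qinf (- q) (q\<^sup>2)) =
      (theta_phi (- (q\<^sup>2)))\<^sup>2 * (qinf q (q\<^sup>2) * qinf (- q) (q\<^sup>2))"
    using phi_ratio[OF q] phi_ratio[OF mq] by simp algebra
  moreover have "qinf q (q\<^sup>2) \<noteq> 0" "qinf (- q) (q\<^sup>2) \<noteq> 0"
    using q by (intro qinf_nonzero; simp)+
  ultimately show ?thesis by simp
qed

lemma psi_square:
  fixes q :: "'a::field fps"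
  assumes q: "q $ 0 = 0"
  shows "(theta_psi q)\<^sup>2 = theta_phi q * theta_psi (q\<^sup>2)"
proof -
  have q2: "q\<^sup>2 $ 0 = 0" using q by simp
  \<comment> \<open>The letters \<open>w\<close>, \<open>x\<close>, \<open>y\<close>,
    \<open>z\<close> stand for theta values, \<open>a\<close>, \<open>b\<close>, \<open>c\<close>,
    \<open>e\<close> for infinite products to the base q^2.\<close>
  have alg: "x\<^sup>2 * (a\<^sup>2 * b) = z * y * (a\<^sup>2 * b)"
    if "x * a = e" "y * (a * b) = e * c" "w * c = e" "z * a = w * b" for a b c e w x y z :: "'a fps"
  proof -
    have "z * y * (a\<^sup>2 * b) = (z * a) * (y * (a * b))"
      by (simp only: power2_eq_square mult_ac)
    also have "\<dots> = (w * c) * (e * b)"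
      unfolding that(2,4) by (simp only: mult_ac)
    also have "\<dots> = (x * a) * (x * a) * b"
      unfolding that(1,3) by (simp only: mult_ac)
    finally show ?thesis by (simp only: power2_eq_square mult_ac)
  qed
  have 1: "theta_psi q * qinf q (q\<^sup>2) = qinf (q\<^sup>2) (q\<^sup>2)"
    by (rule psi_product[OF q])
  have 2: "theta_psi (q\<^sup>2) * (qinf q (q\<^sup>2) * qinf (- q) (q\<^sup>2)) = qinf (q\<^sup>2) (q\<^sup>2) * qinf (- (q\<^sup>2)) (q\<^sup>2)"
    using psi_product[OF q2] by (simp only: qinf_mult_minus[OF q2])
  have 3: "theta_phi (- (q\<^sup>2)) * qinf (- (q\<^sup>2)) (q\<^sup>2) = qinf (q\<^sup>2) (q\<^sup>2)"
    by (rule phi_minus_product[OF q2])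
  have "(theta_psi q)\<^sup>2 * ((qinf q (q\<^sup>2))\<^sup>2 * qinf (- q) (q\<^sup>2)) =
      theta_phi q * theta_psi (q\<^sup>2) * ((qinf q (q\<^sup>2))\<^sup>2 * qinf (- q) (q\<^sup>2))"
    using 1 2 3 phi_ratio[OF q] by (rule alg)
  moreover have "qinf q (q\<^sup>2) \<noteq> 0" "qinf (- q) (q\<^sup>2) \<noteq> 0"
    using q by (intro qinf_nonzero; simp)+
  ultimately show ?thesis by simp
qed

text \<open>A division-free form of psi^9/phi^8 = e K^13: the fifth power completes phi^(-8) to
  phi^(-13).\<close>

lemma psi_power_9_phi_power_5:
  fixes q :: "'a::field fps"
  assumes q: "q $ 0 = 0"
  shows "theta_psi q ^ 9 * theta_phi (- q) ^ 5 = pentagonal q * pentagonal (q\<^sup>2) ^ 13"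
proof -
  have q2: "q\<^sup>2 $ 0 = 0" using q by simp
  define e where "e = pentagonal q"
  define e2 where "e2 = pentagonal (q\<^sup>2)"
  have e: "e = qinf q q" "e2 = qinf (q\<^sup>2) (q\<^sup>2)"
    by (simp_all add: e_def e2_def pentagonal_eq_qinf q q2)
  define n where "n = qinf (- q) q"
  have "theta_phi (- q) * n = e" "e * n = e2"
    unfolding e n_def by (rule phi_minus_product[OF q], rule qinf_mult_minus[OF q])
  then have "theta_phi (- q) * e2 = (theta_phi (- q) * n) * e" by (simp only: mult_ac flip: \<open>e * n = e2\<close>)
  then have phi: "theta_phi (- q) * e2 = e\<^sup>2"
    by (simp only: \<open>theta_phi (- q) * n = e\<close> power2_eq_square)
  define r where "r = qinf q (q\<^sup>2)"
  have "e = r * e2" "theta_psi q * r = e2"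
    unfolding e r_def using qinf_double[OF q, of q] psi_product[OF q] by (simp_all add: power2_eq_square)
  then have psi: "theta_psi q * e = e2\<^sup>2" by algebra
  have "theta_psi q ^ 9 * theta_phi (- q) ^ 5 * (e ^ 9 * e2 ^ 5) = (theta_psi q * e) ^ 9 * (theta_phi (- q) * e2) ^ 5"
    by (simp only: power_mult_distrib mult_ac)
  also have "\<dots> = e * e2 ^ 13 * (e ^ 9 * e2 ^ 5)"
    unfolding phi psi by (simp flip: power_mult power_Suc power_add add: mult_ac)
  finally have "theta_psi q ^ 9 * theta_phi (- q) ^ 5 * (e ^ 9 * e2 ^ 5) = e * e2 ^ 13 * (e ^ 9 * e2 ^ 5)" .
  moreover have "e \<noteq> 0" "e2 \<noteq> 0"
    unfolding e using q by (intro qinf_nonzero; simp)+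
  ultimately show ?thesis by (simp add: e_def e2_def)
qed

lemma phi_dissection:
  fixes q :: "'a::field fps"
  assumes q: "q $ 0 = 0"
  shows "theta_phi q = theta_phi (q ^ 4) + 2 * q * theta_psi (q ^ 8)"
proof -
  have q4: "q ^ 4 $ 0 = 0" and q8: "q ^ 8 $ 0 = 0" using q by simp_all
  \<comment> \<open>Four squares are grouped against two, so that in each group the even indices 4n,
    4n+2 cancel 2n, 2n+1 and the odd squares remain.\<close>
  have "(\<lambda>n. \<Sum>i\<in>{n * 4..<n * 4 + 4}. q ^ i\<^sup>2) sums (\<Sum>n. q ^ n\<^sup>2)"
    by (intro sums_group square_power_sums q) simp
  moreover have "(\<lambda>n. \<Sum>i\<in>{n * 2..<n * 2 + 2}. (q ^ 4) ^ i\<^sup>2) sums (\<Sum>n. (q ^ 4) ^ n\<^sup>2)"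
    by (intro sums_group square_power_sums q4) simp
  ultimately have "(\<lambda>n. (\<Sum>i\<in>{n * 4..<n * 4 + 4}. q ^ i\<^sup>2) - (\<Sum>i\<in>{n * 2..<n * 2 + 2}. (q ^ 4) ^ i\<^sup>2)) sums
      ((\<Sum>n. q ^ n\<^sup>2) - (\<Sum>n. (q ^ 4) ^ n\<^sup>2))"
    by (rule sums_diff_fps)
  moreover have "(\<Sum>i\<in>{n * 4..<n * 4 + 4}. q ^ i\<^sup>2) - (\<Sum>i\<in>{n * 2..<n * 2 + 2}. (q ^ 4) ^ i\<^sup>2) =
      q * ((q ^ 8) ^ (2 * n\<^sup>2 + n) * (1 + (q ^ 8) ^ (2 * n + 1)))" for n
  proof -
    have "{n * 4..<n * 4 + 4} = {4 * n, 4 * n + 1, 4 * n + 2, 4 * n + 3}"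
      "{n * 2..<n * 2 + 2} = {2 * n, 2 * n + 1}" by auto
    then have "(\<Sum>i\<in>{n * 4..<n * 4 + 4}. q ^ i\<^sup>2) - (\<Sum>i\<in>{n * 2..<n * 2 + 2}. (q ^ 4) ^ i\<^sup>2) =
        (q ^ (4 * n)\<^sup>2 + q ^ (4 * n + 1)\<^sup>2 + q ^ (4 * n + 2)\<^sup>2 + q ^ (4 * n + 3)\<^sup>2) -
        ((q ^ 4) ^ (2 * n)\<^sup>2 + (q ^ 4) ^ (2 * n + 1)\<^sup>2)"
      by simp
    also have "(q ^ 4) ^ (2 * n)\<^sup>2 = q ^ (4 * n)\<^sup>2"
      unfolding power_mult [symmetric] by (rule arg_cong [of _ _ "power q"]) (simp add: power2_eq_square)
    also have "(q ^ 4) ^ (2 * n + 1)\<^sup>2 = q ^ (4 * n + 2)\<^sup>2"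
      unfolding power_mult [symmetric]
      by (rule arg_cong [of _ _ "power q"]) (simp add: power2_eq_square algebra_simps)
    also have "q ^ (4 * n + 1)\<^sup>2 = q * (q ^ 8) ^ (2 * n\<^sup>2 + n)"
      unfolding power_mult [symmetric] power_Suc [symmetric]
      by (rule arg_cong [of _ _ "power q"]) (simp add: power2_eq_square algebra_simps)
    also have "q ^ (4 * n + 3)\<^sup>2 = q * (q ^ 8) ^ (2 * n\<^sup>2 + n + (2 * n + 1))"
      unfolding power_mult [symmetric] power_Suc [symmetric]
      by (rule arg_cong [of _ _ "power q"]) (simp add: power2_eq_square algebra_simps)
    finally show ?thesis
      by (simp only: power_add) (simp add: algebra_simps)
  qed
  moreover have "(\<lambda>n. q * ((q ^ 8) ^ (2 * n\<^sup>2 + n) * (1 + (q ^ 8) ^ (2 * n + 1)))) sums (q * theta_psi (q ^ 8))"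
    unfolding theta_psi_def by (intro sums_mult_left_fps adic_null_sums_suminf adic_null_psi_term q8)
  ultimately have "(\<Sum>n. q ^ n\<^sup>2) - (\<Sum>n. (q ^ 4) ^ n\<^sup>2) = q * theta_psi (q ^ 8)"
    using sums_unique2 by (simp only:) blast
  then show ?thesis
    unfolding theta_phi_def by algebra
qed

lemma phi_minus_dissection:
  fixes q :: "'a::field fps"
  assumes q: "q $ 0 = 0"
  shows "theta_phi (- q) = theta_phi (q ^ 4) - 2 * q * theta_psi (q ^ 8)"
  using phi_dissection[of "- q"] q by simp

text \<open>With phi(q) = a + 2qb, the cross term is 4q psi(q^4)^2 by \<open>psi_square\<close>. The
  rest a^2 + 4 q^2 b^2 is phi(q^2)^2, because a^2 - 4 q^2 b^2 = phi(-q^2)^2 and the dissection at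
  q^2 gives phi(q^2)^2 - phi(-q^2)^2 = 8 q^2 b^2.\<close>

lemma phi_square_dissection:
  fixes q :: "'a::field fps"
  assumes q: "q $ 0 = 0"
  shows "(theta_phi q)\<^sup>2 = (theta_phi (q\<^sup>2))\<^sup>2 + 4 * q * (theta_psi (q ^ 4))\<^sup>2"
proof -
  have q2: "q\<^sup>2 $ 0 = 0" and q4: "q ^ 4 $ 0 = 0" and q8: "q ^ 8 $ 0 = 0" using q by simp_all
  note d = phi_dissection[OF q] phi_minus_dissection[OF q]
  have d2: "theta_phi (q\<^sup>2) = theta_phi (q ^ 8) + 2 * q\<^sup>2 * theta_psi (q ^ 16)"
    "theta_phi (- (q\<^sup>2)) = theta_phi (q ^ 8) - 2 * q\<^sup>2 * theta_psi (q ^ 16)"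
    using phi_dissection[OF q2] phi_minus_dissection[OF q2] by (simp_all flip: power_mult)
  have s: "(theta_psi (q ^ 4))\<^sup>2 = theta_phi (q ^ 4) * theta_psi (q ^ 8)" "(theta_psi (q ^ 8))\<^sup>2 = theta_phi (q ^ 8) * theta_psi (q ^ 16)"
    using psi_square[OF q4] psi_square[OF q8] by (simp_all flip: power_mult)
  define a where "a = theta_phi (q ^ 4)"
  define b where "b = theta_psi (q ^ 8)"
  have "(theta_phi (q\<^sup>2))\<^sup>2 - (theta_phi (- (q\<^sup>2)))\<^sup>2 = 8 * q\<^sup>2 * b\<^sup>2"
    unfolding d2 b_def s(2) by algebra
  moreover have "(a + 2 * q * b) * (a - 2 * q * b) = (theta_phi (- (q\<^sup>2)))\<^sup>2"
    using phi_mult_phi_minus[OF q] by (simp only: d a_def b_def)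
  ultimately have "(theta_phi (q\<^sup>2))\<^sup>2 + 4 * q * (a * b) = (a + 2 * q * b)\<^sup>2"
    by algebra
  then show ?thesis
    by (simp only: d s(1) a_def b_def)
qed

text \<open>At s = 1 the quotient of infinite products in \<open>bilateral_sum\<close> is
  phi(q^2)/phi(-q^4), by \<open>phi_ratio\<close> at q^2.\<close>

lemma bilateral_sum_1:
  fixes q :: "'a::field fps"
  assumes q: "q $ 0 = 0"
  shows "(suminf (bilateral_term 1 q) + suminf (bilateral_term (- 1) q) - 1) * theta_phi (- (q ^ 4)) = (theta_phi (q\<^sup>2))\<^sup>2"
proof -
  have q2: "q\<^sup>2 $ 0 = 0" using q by simp
  have q4: "(q\<^sup>2)\<^sup>2 = q ^ 4" by (simp flip: power_mult)
  define F where "F = suminf (bilateral_term 1 q) + suminf (bilateral_term (- 1) q) - 1"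
  have F: "F * qinf (q\<^sup>2) (q ^ 4) = qinf (- (q\<^sup>2)) (q ^ 4) * theta_phi (q\<^sup>2)"
    using bilateral_sum[OF q, of 1] by (simp add: F_def)
  have "F * theta_phi (- (q ^ 4)) * qinf (q\<^sup>2) (q ^ 4) = (F * qinf (q\<^sup>2) (q ^ 4)) * theta_phi (- (q ^ 4))"
    by (simp only: mult_ac)
  also have "\<dots> = (theta_phi (- (q ^ 4)) * qinf (- (q\<^sup>2)) (q ^ 4)) * theta_phi (q\<^sup>2)"
    by (simp only: F mult_ac)
  also have "\<dots> = (theta_phi (q\<^sup>2))\<^sup>2 * qinf (q\<^sup>2) (q ^ 4)"
    unfolding phi_ratio[OF q2, unfolded q4, symmetric] by (simp only: power2_eq_square mult_ac)
  finally have "F * theta_phi (- (q ^ 4)) * qinf (q\<^sup>2) (q ^ 4) = (theta_phi (q\<^sup>2))\<^sup>2 * qinf (q\<^sup>2) (q ^ 4)" .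
  moreover have "qinf (q\<^sup>2) (q ^ 4) \<noteq> 0"
    using q by (intro qinf_nonzero) simp_all
  ultimately show ?thesis by (simp add: F_def)
qed

section \<open>Supports and dissection\<close>

text \<open>An arbitrary set of exponents serves both uses: residue classes in the dissection,
  values of quadratic polynomials in the final congruence.\<close>

definition support_in :: "nat set \<Rightarrow> 'a::zero fps \<Rightarrow> bool" where
  "support_in A f \<longleftrightarrow> (\<forall>n. f $ n \<noteq> 0 \<longrightarrow> n \<in> A)"

definition residue_class :: "nat \<Rightarrow> nat \<Rightarrow> nat set" where
  "residue_class m r = {n. [n = r] (mod m)}"

lemma support_nth_eq_0: "support_in A f \<Longrightarrow> n \<notin> A \<Longrightarrow> f $ n = 0"
  by (auto simp: support_in_def)

lemma support_mult:
  fixes f g :: "'a::comm_ring_1 fps"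
  assumes "support_in A f" "support_in B g" "\<And>i j. i \<in> A \<Longrightarrow> j \<in> B \<Longrightarrow> i + j \<in> C"
  shows "support_in C (f * g)"
  unfolding support_in_def
proof (intro allI impI)
  fix n assume "(f * g) $ n \<noteq> 0"
  then obtain i where "i \<le> n" "f $ i * g $ (n - i) \<noteq> 0"
    unfolding fps_mult_nth by (metis (no_types, lifting) atLeastAtMost_iff sum.not_neutral_contains_not_neutral)
  then have "f $ i \<noteq> 0" "g $ (n - i) \<noteq> 0" by auto
  then show "n \<in> C"
    using assms \<open>i \<le> n\<close> unfolding support_in_def by (metis le_add_diff_inverse)
qed

lemma support_add: "support_in A f \<Longrightarrow> support_in A g \<Longrightarrow> support_in A (f + g :: 'a::comm_ring_1 fps)"
  by (simp add: support_in_def) (metis add_0)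

lemma support_diff: "support_in A f \<Longrightarrow> support_in A g \<Longrightarrow> support_in A (f - g :: 'a::comm_ring_1 fps)"
  by (simp add: support_in_def) metis

lemma support_uminus: "support_in A f \<Longrightarrow> support_in A (- f :: 'a::comm_ring_1 fps)"
  by (auto simp: support_in_def)

lemma support_suminf:
  fixes f :: "nat \<Rightarrow> 'a::comm_ring_1 fps"
  assumes "adic_null f" "\<And>n. support_in A (f n)"
  shows "support_in A (\<Sum>n. f n)"
  unfolding support_in_def suminf_nth[OF assms(1)]
  using assms(2) by (metis (no_types, lifting) support_in_def sum.neutral)

lemma support_X_power: "m \<in> A \<Longrightarrow> support_in A (fps_X ^ m :: 'a::comm_ring_1 fps)"
  by (auto simp: support_in_def fps_X_power_nth)

lemma support_numeral: "0 \<in> A \<Longrightarrow> support_in A (numeral c :: 'a::comm_ring_1 fps)"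
  by (auto simp: support_in_def numeral_fps_const)

lemma support_one: "0 \<in> A \<Longrightarrow> support_in A (1 :: 'a::comm_ring_1 fps)"
  by (auto simp: support_in_def)

lemma support_class_mult:
  fixes f g :: "'a::comm_ring_1 fps"
  assumes "support_in (residue_class m r) f" "support_in (residue_class m s) g"
  shows "support_in (residue_class m (r + s)) (f * g)"
  using assms by (rule support_mult) (auto simp: residue_class_def cong_add)

lemma support_class_power:
  fixes f :: "'a::comm_ring_1 fps"
  assumes "support_in (residue_class m r) f"
  shows "support_in (residue_class m (k * r)) (f ^ k)"
proof (induction k)
  case (Suc k)
  then show ?case using support_class_mult[OF assms] by simp
qed (simp add: support_one residue_class_def)

lemma support_class_cong: "support_in (residue_class m r) f \<Longrightarrow> [r = s] (mod m) \<Longrightarrow> support_in (residue_class m s) f"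
  by (auto simp: support_in_def residue_class_def intro: cong_trans)

lemma support_class_avoid:
  assumes "support_in (residue_class m r) f" "m dvd k" "\<not> [r = s] (mod m)"
  shows "support_in (- residue_class k s) f"
  using assms unfolding support_in_def residue_class_def
  by (metis (mono_tags, lifting) ComplI cong_dvd_modulus_nat cong_sym cong_trans mem_Collect_eq)

text \<open>In the recursion for coefficient n of the inverse, if m does not divide n, then it fails
  to divide i or n - i, so every summand with i > 0 vanishes.\<close>

lemma support_class_inverse:
  fixes f :: "'a::field fps"
  assumes "support_in (residue_class m 0) f" "f $ 0 \<noteq> 0"
  shows "support_in (residue_class m 0) (inverse f)"
proof -
  have "inverse f $ n = 0" if "\<not> m dvd n" for n
    using that
  proof (induction n rule: less_induct)
    case (less n)
    have n: "n \<noteq> 0" using less.prems by (intro notI) simp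
    have "(\<Sum>i=0..n. f $ i * inverse f $ (n - i)) = 0"
      using n inverse_mult_eq_1'[OF assms(2)] by (metis fps_mult_nth fps_one_nth)
    moreover have "(\<Sum>i=0..n. f $ i * inverse f $ (n - i)) =
        f $ 0 * inverse f $ n + (\<Sum>i=Suc 0..n. f $ i * inverse f $ (n - i))"
      by (subst sum.atLeast_Suc_atMost) auto
    moreover have "f $ i * inverse f $ (n - i) = 0" if "i \<in> {Suc 0..n}" for i
    proof (cases "m dvd i")
      case True
      then have "\<not> m dvd n - i"
        using less.prems that by (metis atLeastAtMost_iff dvd_diffD)
      then show ?thesis using less.IH[of "n - i"] that by simp
    next
      case False
      then show ?thesis
        using assms(1) by (auto simp: support_in_def residue_class_def cong_0_iff)
    qed
    ultimately show ?case using assms(2) by simp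
  qed
  then show ?thesis by (auto simp: support_in_def residue_class_def cong_0_iff)
qed

lemma support_class_power_0:
  fixes f :: "'a::comm_ring_1 fps"
  shows "support_in (residue_class m 0) f \<Longrightarrow> support_in (residue_class m 0) (f ^ k)"
  using support_class_power[of m 0 f k] by simp

section \<open>Supports of the theta series\<close>

lemma phi_nth_0: "q $ 0 = 0 \<Longrightarrow> theta_phi q $ 0 = 1"
  using adic_null_power_mult[of q "\<lambda>n. n\<^sup>2" "\<lambda>_. 1"]
  by (simp add: theta_phi_def suminf_nth power2_eq_square numeral_fps_const)

lemma support_phi:
  fixes q :: "'a::field fps"
  assumes "q $ 0 = 0" "support_in (residue_class m 0) q"
  shows "support_in (residue_class m 0) (theta_phi q)"
proof -
  have "adic_null (\<lambda>n. q ^ n\<^sup>2)"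
    using adic_null_power_mult[OF assms(1), of "\<lambda>n. n\<^sup>2" "\<lambda>_. 1"] by (simp add: power2_eq_square)
  then have "support_in (residue_class m 0) (\<Sum>n. q ^ n\<^sup>2)"
    by (rule support_suminf) (rule support_class_power_0[OF assms(2)])
  moreover have "support_in (residue_class m 0) (2 :: 'a fps)"
    by (intro support_numeral) (simp add: residue_class_def)
  ultimately have "support_in (residue_class m 0) (2 * (\<Sum>n. q ^ n\<^sup>2))"
    using support_class_mult by fastforce
  then show ?thesis
    unfolding theta_phi_def by (intro support_diff support_one) (auto simp: residue_class_def)
qed

lemma support_psi:
  fixes q :: "'a::field fps"
  assumes "q $ 0 = 0" "support_in (residue_class m 0) q"
  shows "support_in (residue_class m 0) (theta_psi q)"
  unfolding theta_psi_def
proof (intro support_suminf adic_null_psi_term assms(1))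
  fix n :: nat
  have "support_in (residue_class m 0) (1 + q ^ (2 * n + 1))"
    by (intro support_add support_one support_class_power_0 assms) (simp add: residue_class_def)
  from support_class_mult[OF support_class_power_0[OF assms(2)] this]
  show "support_in (residue_class m 0) (q ^ (2 * n\<^sup>2 + n) * (1 + q ^ (2 * n + 1)))" by simp
qed

text \<open>Completing the square: 8T + 1 is an odd square for triangular T. The substitution of
  \<open>fps_X ^ m\<close> scales the exponents, hence the factor m on both sides.\<close>

lemma support_psi_X_power:
  assumes "m > 0"
  shows "support_in {n. \<exists>k. 8 * n + m = m * k\<^sup>2} (theta_psi (fps_X ^ m :: 'a::field fps))"
  unfolding theta_psi_def
proof (intro support_suminf adic_null_psi_term)
  fix n :: nat
  let ?A = "{n. \<exists>k. 8 * n + m = m * k\<^sup>2}"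
  have "8 * (m * (2 * n\<^sup>2 + n)) + m = m * (4 * n + 1)\<^sup>2"
    "8 * (m * (2 * n\<^sup>2 + n + (2 * n + 1))) + m = m * (4 * n + 3)\<^sup>2"
    by (simp_all add: power2_eq_square algebra_simps)
  then have "m * (2 * n\<^sup>2 + n) \<in> ?A" "m * (2 * n\<^sup>2 + n + (2 * n + 1)) \<in> ?A"
    by blast+
  then have "support_in ?A (fps_X ^ (m * (2 * n\<^sup>2 + n)) + fps_X ^ (m * (2 * n\<^sup>2 + n + (2 * n + 1))) :: 'a fps)"
    by (intro support_add support_X_power)
  then show "support_in ?A ((fps_X ^ m) ^ (2 * n\<^sup>2 + n) * (1 + (fps_X ^ m) ^ (2 * n + 1)) :: 'a fps)"
    by (simp only: distrib_left [of _ 1] mult_1_right power_mult power_add)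
qed (use assms in simp)

lemma double_pentagonal_div: "2 * (n * (3 * n + 1) div 2) = n * (3 * n + 1)" for n :: nat
  by simp

lemma adic_null_pentagonal_term:
  fixes q :: "'a::comm_ring_1 fps"
  assumes "q $ 0 = 0"
  shows "adic_null (\<lambda>n. q ^ (n * (3 * n + 1) div 2) * ((- 1) ^ n * (1 - q ^ (2 * n + 1))))"
proof (intro adic_null_power_mult assms)
  show "n \<le> n * (3 * n + 1) div 2" for n :: nat
    using double_pentagonal_div[of n] by (cases n) (simp_all add: algebra_simps)
qed

text \<open>For the two exponents p in a term, 24p + 1 is (6n+1)^2 and (6n+5)^2.\<close>

lemma support_pentagonal_X_power:
  assumes "m > 0"
  shows "support_in {n. \<exists>k. 24 * n + m = m * k\<^sup>2} (pentagonal (fps_X ^ m :: 'a::field fps))"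
  unfolding pentagonal_def
proof (intro support_suminf adic_null_pentagonal_term)
  fix n :: nat
  let ?A = "{n. \<exists>k. 24 * n + m = m * k\<^sup>2}"
  define p where "p = n * (3 * n + 1) div 2"
  have p: "24 * p = 12 * (n * (3 * n + 1))"
  proof -
    have "24 * p = 12 * (2 * p)" by simp
    then show ?thesis by (simp only: p_def double_pentagonal_div)
  qed
  have "24 * (m * p) + m = m * (24 * p + 1)" "24 * (m * (p + (2 * n + 1))) + m = m * (24 * p + 24 * (2 * n + 1) + 1)"
    by (simp_all add: algebra_simps)
  then have "24 * (m * p) + m = m * (6 * n + 1)\<^sup>2" "24 * (m * (p + (2 * n + 1))) + m = m * (6 * n + 5)\<^sup>2"
    unfolding p by (simp_all add: power2_eq_square algebra_simps)
  then have "m * p \<in> ?A" "m * (p + (2 * n + 1)) \<in> ?A"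
    by blast+
  then have *: "support_in ?A (fps_X ^ (m * p) - fps_X ^ (m * (p + (2 * n + 1))) :: 'a fps)"
    by (intro support_diff support_X_power)
  have "(fps_X ^ m) ^ p * ((- 1) ^ n * (1 - (fps_X ^ m) ^ (2 * n + 1))) =
      (- 1) ^ n * (fps_X ^ (m * p) - fps_X ^ (m * (p + (2 * n + 1))) :: 'a fps)"
    by (simp add: algebra_simps power_add power_mult)
  also have "support_in ?A \<dots>"
    using * support_uminus[OF *] by (cases "even n") simp_all
  finally show "support_in ?A ((fps_X ^ m) ^ (n * (3 * n + 1) div 2) * ((- 1) ^ n * (1 - (fps_X ^ m) ^ (2 * n + 1))) :: 'a fps)"
    by (simp only: p_def)
qed (use assms in simp)

text \<open>
  In the application \<open>b\<close> and \<open>w\<close> carry the exponents that are 4 and 16 modulo 32, so that the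
  terms in the parentheses do not contribute to the exponents that are 4 modulo 32.
\<close>

lemma dissection_algebra:
  fixes a b c d u w A iP iC iD :: "'a::comm_ring_1"
  assumes A: "A * (a - b) = (a + b)\<^sup>2"
    and C: "iC * c ^ 4 = 1" and D: "iD * d ^ 4 = 1"
    and 1: "(a\<^sup>2 - b\<^sup>2) * (a\<^sup>2 + b\<^sup>2) = c ^ 4"
    and 2: "a\<^sup>2 = u + w" and 3: "c\<^sup>2 = u - w" and 4: "a * c = d"
  shows "A = 3 * b + 32 * (b * (u * w)\<^sup>2 * iD) +
    (16 * (b * (u * w * (u\<^sup>2 + w\<^sup>2)) * iD) +
     (a ^ 5 + 4 * (a ^ 3 * b\<^sup>2) + 4 * (a\<^sup>2 * b ^ 3) + 3 * (a * b ^ 4)) * iC)"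
proof -
  let ?R = "a ^ 5 + 4 * (a ^ 3 * b\<^sup>2) + 4 * (a\<^sup>2 * b ^ 3) + 3 * (a * b ^ 4)"
  have "A * c ^ 4 = (A * (a - b)) * ((a + b) * (a\<^sup>2 + b\<^sup>2))"
    unfolding 1 [symmetric] by (simp add: algebra_simps power2_eq_square)
  \<comment> \<open>The terms with b and b^5 are separated from \<open>?R\<close>: they are b (3 a^4
    + b^4), and b^4 = a^4 - c^4.\<close>
  also have "\<dots> = b * (4 * a ^ 4 - (a\<^sup>2 - b\<^sup>2) * (a\<^sup>2 + b\<^sup>2)) + ?R"
    unfolding A by (simp add: algebra_simps eval_nat_numeral)
  finally have *: "A * c ^ 4 = b * (4 * a ^ 4 - c ^ 4) + ?R"
    unfolding 1 .
  have "A = iC * (A * c ^ 4)"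
    using C by (metis mult.left_commute mult.right_neutral)
  also have "\<dots> = 4 * b * (iC * a ^ 4) - b * (iC * c ^ 4) + ?R * iC"
    unfolding * by (simp add: algebra_simps)
  also have "\<dots> = 4 * b * (iC * a ^ 4) - b + ?R * iC"
    unfolding C by simp
  finally have **: "A = 4 * b * (iC * a ^ 4) - b + ?R * iC" .
  \<comment> \<open>Turns a^4/c^4 into a^8/(a c)^4 = a^8/d^4, whose denominator is a series in q^32
    in the application.\<close>
  have "iC * a ^ 4 = iC * a ^ 4 * (iD * (a * c) ^ 4)"
    unfolding 4 D by simp
  also have "\<dots> = (iC * c ^ 4) * (a\<^sup>2) ^ 4 * iD"
    by (simp add: algebra_simps eval_nat_numeral)
  also have "\<dots> = (u + w) ^ 4 * iD"
    unfolding C 2 by simp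
  \<comment> \<open>Sorted by the parity of the power of w. The even part is arranged around u^2 -
    w^2, which equals d^2, so that it contributes 1 after division by d^4.\<close>
  also have "(u + w) ^ 4 = 8 * (u * w)\<^sup>2 + (u\<^sup>2 - w\<^sup>2)\<^sup>2 + 4 * (u * w * (u\<^sup>2 + w\<^sup>2))"
    by (simp add: algebra_simps eval_nat_numeral)
  also have "u\<^sup>2 - w\<^sup>2 = a\<^sup>2 * c\<^sup>2"
    unfolding 2 3 by (simp add: algebra_simps eval_nat_numeral)
  also have "\<dots> = d\<^sup>2"
    unfolding 4 [symmetric] by (simp add: algebra_simps eval_nat_numeral)
  finally have "iC * a ^ 4 = 8 * (u * w)\<^sup>2 * iD + iD * d ^ 4 + 4 * (u * w * (u\<^sup>2 + w\<^sup>2)) * iD"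
    by (simp add: algebra_simps flip: power_mult)
  then have "iC * a ^ 4 = 8 * (u * w)\<^sup>2 * iD + 1 + 4 * (u * w * (u\<^sup>2 + w\<^sup>2)) * iD"
    unfolding D .
  then show ?thesis
    unfolding ** by (simp add: algebra_simps)
qed

lemma bilateral_dissection:
  fixes F :: "'a::field fps"
  defines "P \<equiv> theta_phi (- (fps_X ^ 32)) :: 'a fps"
  assumes F: "F * theta_phi (- (fps_X ^ 4)) = (theta_phi (fps_X\<^sup>2))\<^sup>2"
    and n: "[n = 4] (mod 32)"
  shows "F $ n = (6 * (fps_X ^ 4 * theta_psi (fps_X ^ 32)) +
    1024 * (fps_X ^ 36 * pentagonal (fps_X ^ 32) * (pentagonal (fps_X ^ 64) * inverse P) ^ 13)) $ n"
proof -
  define a where "a = (theta_phi (fps_X ^ 16) :: 'a fps)"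
  define b where "b = (2 * fps_X ^ 4 * theta_psi (fps_X ^ 32) :: 'a fps)"
  define c where "c = (theta_phi (- (fps_X ^ 16)) :: 'a fps)"
  define d where "d = P\<^sup>2"
  define u where "u = ((theta_phi (fps_X ^ 32))\<^sup>2 :: 'a fps)"
  define w where "w = (4 * fps_X ^ 16 * (theta_psi (fps_X ^ 64))\<^sup>2 :: 'a fps)"
  define R where "R = (4 * fps_X\<^sup>2 * (theta_psi (fps_X ^ 8))\<^sup>2 :: 'a fps)"
  define iP where "iP = inverse (theta_phi (- (fps_X ^ 4)) :: 'a fps)"
  define iC where "iC = inverse (c ^ 4)"
  define iD where "iD = inverse (d ^ 4)"
  have X0: "fps_X ^ k $ 0 = (0 :: 'a)" "(- (fps_X ^ k :: 'a fps)) $ 0 = 0" if "k > 0" for k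
    using that by simp_all
  have inv: "iP * theta_phi (- (fps_X ^ 4)) = 1" "iC * c ^ 4 = 1" "iD * d ^ 4 = 1" "inverse P * P = 1"
    unfolding iP_def iC_def iD_def c_def d_def P_def
    by (intro inverse_mult_eq_1; simp add: phi_nth_0 fps_power_zeroth)+
  have ab: "theta_phi (fps_X ^ 4) = a + b" "theta_phi (- (fps_X ^ 4)) = a - b"
    using phi_dissection[OF X0(1), of 4] phi_minus_dissection[OF X0(1), of 4]
    by (simp_all add: a_def b_def flip: power_mult)
  have "F = (F * theta_phi (- (fps_X ^ 4))) * iP"
    using inv(1) by (simp add: mult_ac)
  also have "F * theta_phi (- (fps_X ^ 4)) = (theta_phi (fps_X ^ 4))\<^sup>2 + R"
    unfolding F R_def using phi_square_dissection[OF X0(1), of 2] by (simp flip: power_mult)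
  also have "\<dots> * iP = (a + b)\<^sup>2 * iP + R * iP"
    unfolding ab by (simp add: distrib_right)
  finally have F_eq: "F = (a + b)\<^sup>2 * iP + R * iP" .
  have "(a + b)\<^sup>2 * iP = 3 * b + 32 * (b * (u * w)\<^sup>2 * iD) +
    (16 * (b * (u * w * (u\<^sup>2 + w\<^sup>2)) * iD) +
     (a ^ 5 + 4 * (a ^ 3 * b\<^sup>2) + 4 * (a\<^sup>2 * b ^ 3) + 3 * (a * b ^ 4)) * iC)"
  proof (rule dissection_algebra[where c = c and d = d])
    show "(a + b)\<^sup>2 * iP * (a - b) = (a + b)\<^sup>2"
      using inv(1) by (simp add: ab mult.assoc)
    have 8: "a\<^sup>2 - b\<^sup>2 = (theta_phi (- (fps_X ^ 8)))\<^sup>2"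
      using phi_mult_phi_minus[OF X0(1), of 4] unfolding ab
      by (simp add: algebra_simps power2_eq_square flip: power_mult power_add)
    have "(a + b)\<^sup>2 = (theta_phi (fps_X ^ 8))\<^sup>2 + 4 * fps_X ^ 4 * (theta_psi (fps_X ^ 16))\<^sup>2"
      using phi_square_dissection[OF X0(1), of 4] unfolding ab by (simp flip: power_mult)
    also have "(theta_psi (fps_X ^ 16))\<^sup>2 = a * theta_psi (fps_X ^ 32)"
      using psi_square[OF X0(1), of 16] by (simp add: a_def flip: power_mult)
    finally have "a\<^sup>2 + b\<^sup>2 = (theta_phi (fps_X ^ 8))\<^sup>2"
      by (simp add: b_def power2_eq_square algebra_simps)
    moreover have "theta_phi (fps_X ^ 8) * theta_phi (- (fps_X ^ 8)) = c\<^sup>2"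
      using phi_mult_phi_minus[OF X0(1), of 8] by (simp add: c_def flip: power_mult)
    then have "(theta_phi (fps_X ^ 8) * theta_phi (- (fps_X ^ 8)))\<^sup>2 = c ^ 4"
      by (simp flip: power_mult)
    ultimately show "(a\<^sup>2 - b\<^sup>2) * (a\<^sup>2 + b\<^sup>2) = c ^ 4"
      unfolding 8 by (simp add: power_mult_distrib mult.commute)
    show "a\<^sup>2 = u + w"
      unfolding a_def u_def w_def using phi_square_dissection[OF X0(1), of 16] by (simp flip: power_mult)
    show "c\<^sup>2 = u - w"
      unfolding c_def u_def w_def using phi_square_dissection[OF X0(2), of 16] by (simp flip: power_mult)
    show "a * c = d"
      unfolding a_def c_def d_def P_def using phi_mult_phi_minus[OF X0(1), of 16] by (simp flip: power_mult)
  qed (use inv in auto)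
  moreover have "3 * b = 6 * (fps_X ^ 4 * theta_psi (fps_X ^ 32))"
    by (simp add: b_def mult.assoc)
  moreover have "32 * (b * (u * w)\<^sup>2 * iD) =
      1024 * (fps_X ^ 36 * pentagonal (fps_X ^ 32) * (pentagonal (fps_X ^ 64) * inverse P) ^ 13)"
  proof -
    have "theta_phi (fps_X ^ 32) * theta_psi (fps_X ^ 64) = (theta_psi (fps_X ^ 32) :: 'a fps)\<^sup>2"
      using psi_square[OF X0(1), of 32] by (simp flip: power_mult)
    moreover have "u * w = 4 * fps_X ^ 16 * (theta_phi (fps_X ^ 32) * theta_psi (fps_X ^ 64))\<^sup>2"
      by (simp add: u_def w_def power_mult_distrib mult_ac)
    ultimately have "u * w = 4 * fps_X ^ 16 * theta_psi (fps_X ^ 32) ^ 4"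
      by (simp flip: power_mult)
    \<comment> \<open>The constants are 32 = 2 * 4^2 and 36 = 4 + 2 * 16.\<close>
    then have "b * (u * w)\<^sup>2 = 32 * (fps_X ^ 36 * theta_psi (fps_X ^ 32) ^ 9)"
      unfolding b_def by (simp add: power_mult_distrib mult_ac flip: power_mult power_add power_Suc)
    moreover have "iD = inverse P ^ 8"
      by (simp add: iD_def d_def fps_inverse_power flip: power_mult)
    \<comment> \<open>Inserting a fifth power of 1 exchanges P^(-8) for P^5 P^(-13), as
      \<open>psi_power_9_phi_power_5\<close> requires.\<close>
    then have "theta_psi (fps_X ^ 32) ^ 9 * iD = theta_psi (fps_X ^ 32) ^ 9 * inverse P ^ 8 * (inverse P * P) ^ 5"
      unfolding inv by simp
    then have "theta_psi (fps_X ^ 32) ^ 9 * iD = (theta_psi (fps_X ^ 32) ^ 9 * P ^ 5) * inverse P ^ 13"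
      by (simp add: power_mult_distrib mult_ac flip: power_add)
    then have "theta_psi (fps_X ^ 32) ^ 9 * iD = pentagonal (fps_X ^ 32) * (pentagonal (fps_X ^ 64) * inverse P) ^ 13"
      unfolding P_def using psi_power_9_phi_power_5[OF X0(1), of 32]
      by (simp add: power_mult_distrib mult.assoc flip: power_mult)
    ultimately show ?thesis
      by (simp add: mult.assoc)
  qed
  ultimately have F_eq': "F = (6 * (fps_X ^ 4 * theta_psi (fps_X ^ 32)) +
      1024 * (fps_X ^ 36 * pentagonal (fps_X ^ 32) * (pentagonal (fps_X ^ 64) * inverse P) ^ 13)) +
      (16 * (b * (u * w * (u\<^sup>2 + w\<^sup>2)) * iD) +
       (a ^ 5 + 4 * (a ^ 3 * b\<^sup>2) + 4 * (a\<^sup>2 * b ^ 3) + 3 * (a * b ^ 4)) * iC + R * iP)"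
    unfolding F_eq by (simp only: add.assoc)
  have X: "support_in (residue_class m 0) (fps_X ^ k :: 'a fps)" "support_in (residue_class m 0) (- (fps_X ^ k) :: 'a fps)"
    if "m dvd k" for m k
    using that by (auto intro!: support_uminus support_X_power simp: residue_class_def cong_0_iff)
  have phi: "support_in (residue_class m 0) (theta_phi (fps_X ^ k) :: 'a fps)" "support_in (residue_class m 0) (theta_phi (- (fps_X ^ k)) :: 'a fps)"
    and psi: "support_in (residue_class m 0) (theta_psi (fps_X ^ k) :: 'a fps)"
    if "m dvd k" "k > 0" for m k
    using that by (intro support_phi support_psi X X0; simp)+
  have X': "support_in (residue_class m k) (fps_X ^ k :: 'a fps)" for m k
    by (intro support_X_power) (simp add: residue_class_def)
  have num: "support_in (residue_class m 0) (numeral k :: 'a fps)" for m k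
    by (intro support_numeral) (simp add: residue_class_def)
  note mult = support_class_mult support_class_power
  have a: "support_in (residue_class 16 0) a" unfolding a_def by (intro phi) simp_all
  have c: "support_in (residue_class 16 0) c" unfolding c_def by (intro phi) simp_all
  have P: "support_in (residue_class 32 0) P" unfolding P_def by (intro phi) simp_all
  \<comment> \<open>The unevaluated residues, here and below, have the shape that
    \<open>support_class_mult\<close> produces; they are computed when a class is compared with
    4.\<close>
  have b: "support_in (residue_class m (0 + 4 + 0)) b" if "m dvd 32" for m
    unfolding b_def by (intro mult num X' psi that) simp
  have u: "support_in (residue_class 32 (2 * 0)) u" unfolding u_def by (intro mult phi) simp_all
  have w: "support_in (residue_class 32 (0 + 16 + 2 * 0)) w" unfolding w_def by (intro mult num X' psi) simp_all
  have R: "support_in (residue_class 4 (0 + 2 + 2 * 0)) R"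
    unfolding R_def by (intro mult num X' psi) simp_all
  have iP: "support_in (residue_class 4 0) iP"
    unfolding iP_def by (intro support_class_inverse phi) (simp_all add: phi_nth_0)
  have iC: "support_in (residue_class 16 0) iC"
    unfolding iC_def using support_class_power_0[OF c, of 4]
    by (intro support_class_inverse) (simp_all add: c_def phi_nth_0 fps_power_zeroth)
  have iD: "support_in (residue_class 32 0) iD"
    unfolding iD_def d_def using support_class_power_0[OF support_class_power_0[OF P], of 2 4]
    by (intro support_class_inverse) (simp_all add: P_def phi_nth_0 fps_power_zeroth)
  have w2: "support_in (residue_class 32 0) (u\<^sup>2 + w\<^sup>2)"
    using support_class_power[OF u, of 2] support_class_power[OF w, of 2]
    by (intro support_add) (auto elim!: support_class_cong simp: cong_def)
  \<comment> \<open>The residue is 4 + 16 = 20 modulo 32.\<close>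
  have "support_in (residue_class 32 (0 + (0 + 4 + 0 + (2 * 0 + (0 + 16 + 2 * 0) + 0) + 0)))
      (16 * (b * (u * w * (u\<^sup>2 + w\<^sup>2)) * iD))"
    by (intro support_class_mult num b u w w2 iD) simp
  then have 1: "support_in (- residue_class 32 4) (16 * (b * (u * w * (u\<^sup>2 + w\<^sup>2)) * iD))"
    by (rule support_class_avoid) (simp_all add: cong_def)
  have b': "support_in (residue_class 16 (k * 4)) (b ^ k)" for k
    using support_class_power[OF b, of 16 k] by simp
  have a': "support_in (residue_class 16 0) (a ^ k)" for k
    by (rule support_class_power_0[OF a])
  \<comment> \<open>The residues modulo 16 are 0, 8, 12, 0, none of them 4.\<close>
  have "support_in (residue_class 16 (0 + 0)) (a ^ 5 * iC)"
    "support_in (residue_class 16 (0 + (0 + 2 * 4) + 0)) (4 * (a ^ 3 * b\<^sup>2) * iC)"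
    "support_in (residue_class 16 (0 + (0 + 3 * 4) + 0)) (4 * (a\<^sup>2 * b ^ 3) * iC)"
    "support_in (residue_class 16 (0 + (0 + 4 * 4) + 0)) (3 * (a * b ^ 4) * iC)"
    by (intro support_class_mult num a a' b' iC)+
  then have "support_in (- residue_class 32 4) (a ^ 5 * iC)"
    "support_in (- residue_class 32 4) (4 * (a ^ 3 * b\<^sup>2) * iC)"
    "support_in (- residue_class 32 4) (4 * (a\<^sup>2 * b ^ 3) * iC)"
    "support_in (- residue_class 32 4) (3 * (a * b ^ 4) * iC)"
    by (auto elim!: support_class_avoid simp: cong_def)
  then have 2: "support_in (- residue_class 32 4) ((a ^ 5 + 4 * (a ^ 3 * b\<^sup>2) + 4 * (a\<^sup>2 * b ^ 3) + 3 * (a * b ^ 4)) * iC)"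
    unfolding distrib_right by (intro support_add)
  have "support_in (residue_class 4 (0 + 2 + 2 * 0 + 0)) (R * iP)"
    by (intro support_class_mult R iP)
  then have 3: "support_in (- residue_class 32 4) (R * iP)"
    by (rule support_class_avoid) (simp_all add: cong_def)
  have "n \<notin> - residue_class 32 4"
    using n by (simp add: residue_class_def)
  with support_add[OF 1 support_add[OF 2 3]] have "(16 * (b * (u * w * (u\<^sup>2 + w\<^sup>2)) * iD) +
       ((a ^ 5 + 4 * (a ^ 3 * b\<^sup>2) + 4 * (a\<^sup>2 * b ^ 3) + 3 * (a * b ^ 4)) * iC + R * iP)) $ n = 0"
    by (rule support_nth_eq_0)
  then show ?thesis
    by (subst F_eq') (simp only: fps_add_nth [of _ _ n] add.assoc add_0_right)
qed

section \<open>The generating function of \<open>v0\<close>\<close>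

lemma bilateral_term_eq_v0_term: "bilateral_term 1 fps_X n = v0_term n"
proof -
  have "(\<Prod>i<n. 1 + fps_X ^ (2 * i + 1)) = qpoch (- fps_X :: rat fps) (fps_X\<^sup>2) n"
    using prod_eq_qpoch[of "- fps_X" "fps_X\<^sup>2" n] by (simp add: power_mult)
  then show ?thesis
    by (simp only: bilateral_term_def v0_term_altdef mult_1_left)
qed

text \<open>The signs (-1)^n from the product and (-1)^(n^2) from the power cancel.\<close>

lemma bilateral_term_minus:
  fixes q :: "'a::field fps"
  shows "bilateral_term (- 1) q n = bilateral_term 1 (- q) n"
proof -
  have "(\<Prod>i<n. - 1 + q ^ (2 * i + 1)) = (- 1) ^ n * (\<Prod>i<n. 1 + (- q) ^ (2 * i + 1))"
    by (induction n) (simp_all add: algebra_simps)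
  moreover have "(- q) ^ n\<^sup>2 = (- 1) ^ n * q ^ n\<^sup>2"
    by (simp add: power_minus [of q] power2_eq_square minus_one_power_iff)
  ultimately show ?thesis
    by (simp add: bilateral_term_def mult_ac)
qed

text \<open>With \<open>a = - fps_X\<close> this realises q -> -q as a composition, whose effect on
  coefficients is a sign.\<close>

lemma bilateral_term_1_compose:
  fixes a q :: "'a::field fps"
  assumes "a $ 0 = 0" "q $ 0 = 0"
  shows "bilateral_term 1 q n oo a = bilateral_term 1 (q oo a) n"
proof -
  have "(\<Prod>i<n. 1 + q ^ (2 * i + 1)) oo a = (\<Prod>i<n. 1 + (q oo a) ^ (2 * i + 1))"
    using assms by (simp add: fps_compose_prod_distrib fps_compose_add_distrib fps_compose_mult_distrib fps_compose_power)
  moreover have "qpoch q (q\<^sup>2) n oo a = qpoch (q oo a) ((q oo a)\<^sup>2) n"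
    unfolding prod_eq_qpoch [symmetric] using assms
    by (simp add: fps_compose_prod_distrib fps_compose_sub_distrib fps_compose_mult_distrib fps_compose_power)
  ultimately show ?thesis
    using assms by (simp add: bilateral_term_def fps_compose_mult_distrib fps_compose_power fps_inverse_compose qpoch_nth_0)
qed

text \<open>Even coefficients of V(q) and V(-q) agree, and n > 0 avoids the constant -1. The factor
  2 later halves 6 and 1024 to 3 and 512.\<close>

lemma v0_nth:
  assumes "even n" "n > 0"
  shows "(suminf (bilateral_term 1 fps_X) + suminf (bilateral_term (- 1) fps_X) - 1) $ n = (2 * of_int (v0 n) :: rat)"
proof -
  have null: "adic_null (bilateral_term s fps_X :: nat \<Rightarrow> rat fps)" for s
    by (intro adic_null_u_term) simp
  have "bilateral_term 1 fps_X = v0_term"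
    by (rule ext) (rule bilateral_term_eq_v0_term)
  then have V: "suminf (bilateral_term 1 fps_X) = Abs_fps (\<lambda>n. of_int (v0 n) :: rat)"
    using v0_sums by (simp add: sums_iff)
  have "bilateral_term (- 1) fps_X k $ n = (bilateral_term 1 fps_X k $ n :: rat)" for k
  proof -
    have m: "- fps_X = fps_const (- 1) * (fps_X :: rat fps)"
      by (simp flip: fps_const_neg)
    have "bilateral_term (- 1) fps_X k = bilateral_term 1 fps_X k oo (- fps_X :: rat fps)"
      by (simp add: bilateral_term_minus bilateral_term_1_compose)
    then show ?thesis
      unfolding m fps_nth_compose_linear using assms(1) by (simp only:) (simp add: m)
  qed
  then have "suminf (bilateral_term (- 1) fps_X) $ n = (suminf (bilateral_term 1 fps_X) $ n :: rat)"
    by (simp add: suminf_nth null)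
  then show ?thesis
    using assms(2) by (simp add: V)
qed

lemma v0_dissection:
  assumes n: "[n = 4] (mod 32)"
  shows "(of_int (v0 n) :: rat) = (3 * (fps_X ^ 4 * theta_psi (fps_X ^ 32)) +
    512 * (fps_X ^ 36 * pentagonal (fps_X ^ 32) *
      (pentagonal (fps_X ^ 64) * inverse (theta_phi (- (fps_X ^ 32)))) ^ 13)) $ n" (is "_ = ?f $ n")
proof -
  have "n mod 32 = 4" using n by (simp add: cong_def)
  then obtain q where "n = q * 32 + 4"
    using div_mult_mod_eq[of n 32] by metis
  then have "even n" "n > 0" by simp_all
  have "2 * of_int (v0 n) = (2 * ?f) $ n"
    unfolding v0_nth[OF \<open>even n\<close> \<open>n > 0\<close>, symmetric]
    by (subst bilateral_dissection[OF bilateral_sum_1 n]) (simp_all add: distrib_left)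
  then show ?thesis by (simp add: numeral_fps_const)
qed

section \<open>Arithmetic modulo 13\<close>

text \<open>The derivative of \<open>f ^ p\<close> is divisible by \<open>p\<close>.\<close>

lemma prime_power_nth_dvd:
  fixes f :: "rat fps"
  assumes "prime p" "\<And>n. f $ n \<in> \<int>" "\<not> p dvd n"
  shows "\<exists>t. (f ^ p) $ n = of_nat p * of_int t"
proof -
  have "n > 0" using assms(3) by (intro gr0I) simp
  have int: "(f ^ k) $ m \<in> \<int>" for k m
    by (rule int_coeffs_power) (rule assms(2))
  obtain c where c: "(f ^ p) $ n = of_int c"
    by (rule Ints_cases[OF int])
  have "(fps_deriv f * f ^ (p - 1)) $ (n - 1) \<in> \<int>"
    using assms(2) int by (intro int_coeffs_mult) (auto intro!: Ints_mult)
  then obtain d where d: "(fps_deriv f * f ^ (p - 1)) $ (n - 1) = of_int d"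
    by (rule Ints_cases)
  have "of_nat n * (f ^ p) $ n = fps_deriv (f ^ p) $ (n - 1)"
    using \<open>n > 0\<close> by simp
  also have "\<dots> = of_nat p * of_int d"
    unfolding fps_deriv_power mult.assoc fps_mult_left_const_nth d ..
  finally have "of_int (int n * c) = (of_int (int p * d) :: rat)"
    by (simp add: c)
  then have "int p dvd int n * c"
    by (metis dvd_triv_left of_int_eq_iff)
  then have "int p dvd c"
    using assms(1,3) by (metis int_dvd_int_iff prime_dvd_mult_iff prime_int_nat_transfer nat_int of_nat_0_le_iff)
  then show ?thesis
    unfolding c by (metis dvdE of_int_mult of_int_of_nat_eq)
qed

lemma int_coeffs_suminf:
  fixes f :: "nat \<Rightarrow> rat fps"
  assumes "adic_null f" "\<And>n i. f n $ i \<in> \<int>"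
  shows "suminf f $ i \<in> \<int>"
  using assms by (simp add: suminf_nth Ints_sum)

lemma int_coeffs_pentagonal:
  fixes q :: "rat fps"
  assumes "q $ 0 = 0" "\<And>n. q $ n \<in> \<int>"
  shows "pentagonal q $ i \<in> \<int>"
  unfolding pentagonal_def
proof (intro int_coeffs_suminf adic_null_pentagonal_term assms)
  have one: "(1 :: rat fps) $ k \<in> \<int>" "(- 1 :: rat fps) $ k \<in> \<int>" for k
    by (simp_all add: fps_one_nth)
  have pow: "(q ^ k) $ i \<in> \<int>" for k i
    by (rule int_coeffs_power) (rule assms)
  have "(1 - q ^ (2 * n + 1)) $ i \<in> \<int>" for n i
    unfolding fps_sub_nth by (intro Ints_diff one pow)
  then show "(q ^ (n * (3 * n + 1) div 2) * ((- 1) ^ n * (1 - q ^ (2 * n + 1)))) $ i \<in> \<int>" for n i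
    by (intro int_coeffs_mult int_coeffs_power one pow)
qed

lemma int_coeffs_phi:
  fixes q :: "rat fps"
  assumes "q $ 0 = 0" "\<And>n. q $ n \<in> \<int>"
  shows "theta_phi q $ i \<in> \<int>"
proof -
  have "suminf (\<lambda>n. q ^ n\<^sup>2) $ i \<in> \<int>"
    using adic_null_power_mult[OF assms(1), of "\<lambda>n. n\<^sup>2" "\<lambda>_. 1"] int_coeffs_power[OF assms(2)]
    by (intro int_coeffs_suminf) (simp_all add: power2_eq_square)
  then show ?thesis
    by (simp add: theta_phi_def numeral_fps_const fps_one_nth)
qed

section \<open>Quadratic residues modulo 13 and the congruence\<close>

lemma less_13_cases:
  fixes m :: nat
  assumes "m < 13"
  shows "m \<in> {0, 1, 2, 3, 4, 5, 6, 7, 8, 9, 10, 11, 12}"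
  using assms by (auto simp: numeral_eq_Suc less_Suc_eq)

lemma square_mod_13: "k\<^sup>2 mod 13 \<in> {0, 1, 3, 4, 9, 10, 12 :: nat}"
proof -
  have "k\<^sup>2 mod 13 = (k mod 13)\<^sup>2 mod 13" by (simp add: power_mod)
  moreover have "k mod 13 \<in> {0, 1, 2, 3, 4, 5, 6, 7, 8, 9, 10, 11, 12}"
    by (rule less_13_cases) simp
  ultimately show ?thesis by auto
qed

theorem theorem5p2:
  fixes n r :: nat
  assumes "r \<in> {132, 164, 228, 292, 356, 388}"
  shows "[v0 (416 * n + r) = 0] (mod 13)"
proof -
  define N where "N = 416 * n + r"
  define K where "K = (pentagonal (fps_X ^ 64) * inverse (theta_phi (- (fps_X ^ 32))) :: rat fps)"
  define G where "G = (fps_X ^ 36 * pentagonal (fps_X ^ 32) :: rat fps)"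
  \<comment> \<open>2, 5, 6, 7, 8, 11 are the quadratic nonresidues modulo 13.\<close>
  have "r mod 32 = 4" and r13: "r mod 13 \<in> {2, 5, 6, 7, 8, 11}"
    using assms by auto
  have "N mod 32 = r mod 32"
    using mod_mult_self2[of r 32 "13 * n"] by (simp add: N_def add.commute)
  then have N32: "[N = 4] (mod 32)"
    using \<open>r mod 32 = 4\<close> by (simp add: cong_def)
  have "N mod 13 = r mod 13"
    using mod_mult_self2[of r 13 "32 * n"] by (simp add: N_def add.commute)
  then have N13: "N mod 13 \<in> {2, 5, 6, 7, 8, 11}"
    using r13 by simp
  have X: "(fps_X ^ k :: rat fps) $ i \<in> \<int>" "(- (fps_X ^ k) :: rat fps) $ i \<in> \<int>" for k i
    by (auto simp: fps_X_power_nth)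
  have K: "K $ i \<in> \<int>" for i
    unfolding K_def
    by (intro int_coeffs_mult int_coeffs_pentagonal int_coeffs_inverse int_coeffs_phi X) (simp_all add: phi_nth_0)
  have G: "G $ i \<in> \<int>" for i
    unfolding G_def by (intro int_coeffs_mult int_coeffs_pentagonal X) simp
  have "(fps_X ^ 4 * theta_psi (fps_X ^ 32) :: rat fps) $ N = 0"
  proof (rule support_nth_eq_0)
    show "support_in {n. \<exists>k. n = (2 * k)\<^sup>2} (fps_X ^ 4 * theta_psi (fps_X ^ 32) :: rat fps)"
    proof (rule support_mult[OF support_X_power[of 4 "{4}"] support_psi_X_power[of 32]])
      fix i j :: nat
      assume "i \<in> {4}" "j \<in> {j. \<exists>k. 8 * j + 32 = 32 * k\<^sup>2}"
      then obtain k where "i = 4" "8 * j + 32 = 32 * k\<^sup>2" by auto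
      then have "i + j = (2 * k)\<^sup>2" by (simp add: power_mult_distrib)
      then show "i + j \<in> {n. \<exists>k. n = (2 * k)\<^sup>2}" by blast
    qed simp_all
    show "N \<notin> {n. \<exists>k. n = (2 * k)\<^sup>2}"
    proof
      assume "N \<in> {n. \<exists>k. n = (2 * k)\<^sup>2}"
      then obtain k where "N = (2 * k)\<^sup>2" by blast
      with N13 square_mod_13[of "2 * k"] show False by auto
    qed
  qed
  moreover have "\<exists>t. (G * K ^ 13) $ N = 13 * of_int t"
  proof -
    \<comment> \<open>If 13 does not divide N - i, then 13 divides the coefficient of K^13.
      Otherwise i is a nonresidue together with N, and the coefficient of G is 0.\<close>
    have "\<exists>t. G $ i * (K ^ 13) $ (N - i) = 13 * of_int t" if "i \<le> N" for i
    proof (cases "13 dvd N - i")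
      case True
      have "support_in {n. \<exists>k. 3 * n = 104 + 4 * k\<^sup>2} G"
        unfolding G_def
      proof (rule support_mult[OF support_X_power[of 36 "{36}"] support_pentagonal_X_power[of 32]])
        fix i j :: nat
        assume "i \<in> {36}" "j \<in> {j. \<exists>k. 24 * j + 32 = 32 * k\<^sup>2}"
        then obtain k where "i = 36" "24 * j + 32 = 32 * k\<^sup>2" by auto
        \<comment> \<open>3 * 36 + 3j = 108 + 4 (k^2 - 1).\<close>
        then have "3 * (i + j) = 104 + 4 * k\<^sup>2" by simp
        then show "i + j \<in> {n. \<exists>k. 3 * n = 104 + 4 * k\<^sup>2}" by blast
      qed simp_all
      \<comment> \<open>104 = 8 * 13 drops out modulo 13, which would make 3i, hence i, a square
        modulo 13.\<close>
      moreover have "3 * i \<noteq> 104 + 4 * k\<^sup>2" for k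
      proof
        assume "3 * i = 104 + 4 * k\<^sup>2"
        then have *: "(3 * (i mod 13)) mod 13 = (4 * (k\<^sup>2 mod 13)) mod 13"
          by (simp add: mod_simps mod_add_left_eq [of 104, symmetric])
        from True that have "N mod 13 = i mod 13"
          by (simp add: mod_eq_dvd_iff_nat)
        with N13 have "i mod 13 \<in> {2, 5, 6, 7, 8, 11}" by simp
        with * square_mod_13[of k] show False by auto
      qed
      ultimately have "G $ i = 0"
        by (intro support_nth_eq_0) auto
      then show ?thesis by (intro exI[of _ 0]) simp
    next
      case False
      obtain g where "G $ i = of_int g" by (rule Ints_cases[OF G])
      moreover obtain t where "(K ^ 13) $ (N - i) = of_nat 13 * of_int t"
        using prime_power_nth_dvd[of 13 K "N - i"] K False by auto
      ultimately have "G $ i * (K ^ 13) $ (N - i) = 13 * of_int (g * t)" by simp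
      then show ?thesis ..
    qed
    then obtain t where "\<And>i. i \<le> N \<Longrightarrow> G $ i * (K ^ 13) $ (N - i) = 13 * of_int (t i)"
      by metis
    then have "(G * K ^ 13) $ N = 13 * of_int (\<Sum>i=0..N. t i)"
      by (simp add: fps_mult_nth sum_distrib_left)
    then show ?thesis ..
  qed
  ultimately obtain t where "of_int (v0 N) = (of_int (13 * (512 * t)) :: rat)"
    using v0_dissection[OF N32] unfolding K_def [symmetric] G_def [symmetric]
    by (auto simp: numeral_fps_const)
  then have "v0 N = 13 * (512 * t)"
    by (simp only: of_int_eq_iff)
  then show ?thesis
    by (simp add: N_def cong_0_iff)
qed

end
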